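(* Let $0<\alpha\le 1$. Let $q,\tilde q$ be real-valued continuous functions on $[0,\pi]$ and $h,H,\tilde h,\tilde H\in\mathbb{R}$. Let $\{\lambda_n\}_{n\ge0}$ be the eigenvalues and $\{\alpha_n\}_{n\ge0}$ the norming constants (defined in the context) of the problem $L_\alpha(q,h,H)$: $$-D_x^\alpha D_x^\alpha y+q(x)y=\lambda y,\ 0<x<\pi,\qquad D_x^\alpha y(0)-hy(0)=0,\qquad D_x^\alpha y(\pi)+Hy(\pi)=0,$$ and let $\{\tilde\lambda_n\}_{n\ge0}$, $\{\tilde\alpha_n\}_{n\ge0}$ be those of $L_\alpha(\tilde q,\tilde h,\tilde H)$. If $\lambda_n=\tilde\lambda_n$ and $\alpha_n=\tilde\alpha_n$ for all $n\ge0$, then $q(x)=\tilde q(x)$ a.e. on $[0,\pi]$, $h=\tilde h$ and $H=\tilde H$.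
   Context: $D_x^\alpha$ denotes the conformable fractional derivative of order $\alpha$: for $x>0$, $D^\alpha f(x)=\lim_{\varepsilon\to 0}\frac{f(x+\varepsilon x^{1-\alpha})-f(x)}{\varepsilon}$, and $D^\alpha f(0)=\lim_{x\to0^+}D^\alpha f(x)$ (for differentiable $f$, $D^\alpha f(x)=x^{1-\alpha}f'(x)$). $\lambda$ is a complex spectral parameter. The eigenvalues are real and simple, enumerated in increasing order. Let $\varphi(x,\lambda)$ be the solution of $-D_x^\alpha D_x^\alpha y+q(x)y=\lambda y$ with $\varphi(0,\lambda)=1$, $D_x^\alpha\varphi(0,\lambda)=h$. The norming constants are $\alpha_n=\int_0^\pi \varphi^2(x,\lambda_n)\,x^{\alpha-1}\,dx$ (the symbol $\alpha_n$ is unrelated to the order $\alpha$). Tilded objects are defined analogously for $\tilde q,\tilde h,\tilde H$. *)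

theory Defs
  imports "HOL-Analysis.Analysis"
begin

text \<open>Conformable fractional derivative of order a on the interval [0,pi], at a point x > 0:
  D^a f(x) = lim_{e -> 0} (f(x + e x^(1-a)) - f(x)) / e, the limit taken over those e
  for which x + e x^(1-a) stays in [0,pi] (one-sided at the endpoint pi).\<close>
definition conf_has_deriv :: "real \<Rightarrow> (real \<Rightarrow> 'a::real_normed_vector) \<Rightarrow> 'a \<Rightarrow> real \<Rightarrow> bool" where
  "conf_has_deriv a f D x \<longleftrightarrow> x > 0 \<and>
     ((\<lambda>e. (f (x + e * x powr (1 - a)) - f x) /\<^sub>R e) \<longlongrightarrow> D)
       (at 0 within {e. x + e * x powr (1 - a) \<in> {0..pi}})"

text \<open>y solves  -D^a D^a y + q y = lam y  on (0,pi), with Dy its conformable derivative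
  on (0,pi] and Dy 0 = D^a y(0) = lim_{x->0+} D^a y(x); y is continuous on [0,pi].\<close>
definition conf_sol :: "real \<Rightarrow> (real \<Rightarrow> real) \<Rightarrow> 'a::real_normed_field \<Rightarrow>
    (real \<Rightarrow> 'a) \<Rightarrow> (real \<Rightarrow> 'a) \<Rightarrow> bool" where
  "conf_sol a q lam y Dy \<longleftrightarrow>
     continuous_on {0..pi} y \<and>
     (\<forall>x\<in>{0<..pi}. conf_has_deriv a y (Dy x) x) \<and>
     (Dy \<longlongrightarrow> Dy 0) (at_right 0) \<and>
     (\<forall>x\<in>{0<..<pi}. conf_has_deriv a Dy ((of_real (q x) - lam) * y x) x)"

definition conf_eigenvalue :: "real \<Rightarrow> (real \<Rightarrow> real) \<Rightarrow> real \<Rightarrow> real \<Rightarrow> complex \<Rightarrow> bool" where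
  "conf_eigenvalue a q h H lam \<longleftrightarrow>
     (\<exists>y Dy. conf_sol a q lam y Dy \<and> (\<exists>x\<in>{0..pi}. y x \<noteq> 0) \<and>
        Dy 0 - of_real h * y 0 = 0 \<and> Dy pi + of_real H * y pi = 0)"

end

theory Submission
  imports Defs "HOL-Complex_Analysis.Complex_Analysis"
begin

text \<open>The substitution \<open>t = x\<^sup>a / a\<close> turns the problem into the classical Sturm--Liouville problem
  \<open>-u'' + p u = \<lambda> u\<close> on \<open>[0, T]\<close>. Let \<open>\<phi>\<close> and \<open>\<psi>\<close> be the solutions satisfying the left and the right
  boundary condition, normalised by \<open>\<phi>(0) = 1\<close> and \<open>\<psi>(T) = 1\<close>, and let \<open>\<Delta> = \<phi>'(T) + H \<phi>(T)\<close>. The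
  Weyl solution \<open>\<Phi> = \<psi> / \<Delta>\<close> has simple poles at the eigenvalues \<open>\<lambda>\<^sub>n\<close> with residue
  \<open>- \<phi>(t, \<lambda>\<^sub>n) / \<alpha>\<^sub>n\<close>. If two problems share the spectral data, the poles of
  \<open>P = \<Phi> \<phi>\<^sub>2 - \<phi> \<Phi>\<^sub>2\<close> (index 2 for the second problem) therefore cancel, so \<open>P\<close> is entire in \<open>\<lambda>\<close>. With
  \<open>\<lambda> = \<rho>\<^sup>2\<close>, the bounds \<open>|\<phi>| \<le> C e^(|Im \<rho>| t)\<close>, \<open>|\<psi>| \<le> C e^(|Im \<rho>| (T - t))\<close> and
  \<open>|\<Delta>| \<ge> c |\<rho>| e^(|Im \<rho>| T)\<close> on the circles \<open>|\<rho>| = (n + 1/2) \<pi> / T\<close> make \<open>P\<close> tend to zero there, hence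
  \<open>P = 0\<close>. Differentiating \<open>\<Phi> \<phi>\<^sub>2 = \<phi> \<Phi>\<^sub>2\<close> in \<open>t\<close> and using that both Wronskians equal 1 gives
  \<open>\<phi>\<^sup>2 = \<phi>\<^sub>2\<^sup>2\<close>. For a very negative \<open>\<lambda>\<close> both functions are close to the same hyperbolic cosine, so
  they agree and do not vanish, and the differential equation returns the potential.\<close>

section \<open>Integral inequalities\<close>

text \<open>Integrating an exponential weight of rate \<open>k\<close> gains a factor
  \<open>1 / k\<close>. Gronwall's inequality and the convergence of the Neumann series both rest on
  this gain.\<close>

lemma norm_integral_exp_bound:
  fixes f :: "real \<Rightarrow> 'a::banach"
  assumes "continuous_on {0..t} f" "\<And>s. s \<in> {0..t} \<Longrightarrow> norm (f s) \<le> M * exp (k * s)"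
    and "0 < k" "0 \<le> M" "0 \<le> t"
  shows "norm (integral {0..t} f) \<le> M / k * exp (k * t)"
proof -
  have "((\<lambda>s. M * exp (k * s)) has_integral M / k * exp (k * t) - M / k * exp (k * 0)) {0..t}"
    using assms
    by (intro fundamental_theorem_of_calculus)
       (auto intro!: derivative_eq_intros simp flip: has_real_derivative_iff_has_vector_derivative)
  then have i: "((\<lambda>s. M * exp (k * s)) has_integral M / k * exp (k * t) - M / k) {0..t}"
    by simp
  have "norm (integral {0..t} f) \<le> integral {0..t} (\<lambda>s. M * exp (k * s))"
    using assms i by (intro integral_norm_bound_integral integrable_continuous_real) (auto intro!: continuous_intros)
  also have "\<dots> = M / k * exp (k * t) - M / k"
    using i by (rule integral_unique)
  also have "\<dots> \<le> M / k * exp (k * t)"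
    using assms by simp
  finally show ?thesis .
qed

lemma uniform_limit_integral_tendsto:
  fixes f :: "nat \<Rightarrow> real \<Rightarrow> 'a::banach"
  assumes "uniform_limit {a..b} f g sequentially" "\<And>n. continuous_on {a..b} (f n)"
  shows "(\<lambda>n. integral {a..b} (f n)) \<longlonglongrightarrow> integral {a..b} g"
proof -
  obtain I J where "\<And>n. (f n has_integral I n) {a..b}" "(g has_integral J) {a..b}" "I \<longlonglongrightarrow> J"
    using uniform_limit_integral[OF assms] by auto
  moreover from this have "integral {a..b} (f n) = I n" "integral {a..b} g = J" for n
    by (auto intro: integral_unique)
  ultimately show ?thesis
    by simp
qed

text \<open>The weighted function \<open>f t * exp (- (2 * B) * t)\<close> attains its maximum at
  some \<open>m\<close>. There the integral term is at most half of \<open>f m\<close>, so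
  \<open>f m \<le> 2 * c\<close>, and the weighted bound spreads to all \<open>t\<close>. The two
  factors 2 are the price of this short argument.\<close>

lemma gronwall_bound:
  fixes f :: "real \<Rightarrow> real"
  assumes cont: "continuous_on {0..T} f" and nonneg: "\<And>t. t \<in> {0..T} \<Longrightarrow> 0 \<le> f t"
    and B: "0 < B" and c: "0 \<le> c"
    and le: "\<And>t. t \<in> {0..T} \<Longrightarrow> f t \<le> c + B * integral {0..t} f"
    and t: "t \<in> {0..T}"
  shows "f t \<le> 2 * c * exp (2 * B * t)"
proof -
  let ?g = "\<lambda>t. f t * exp (- (2 * B) * t)"
  have "continuous_on {0..T} ?g"
    by (intro continuous_intros cont)
  then obtain m where m: "m \<in> {0..T}" "\<And>s. s \<in> {0..T} \<Longrightarrow> ?g s \<le> ?g m"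
    using continuous_attains_sup[of "{0..T}" ?g] t by auto
  have *: "f s \<le> ?g m * exp (2 * B * s)" if "s \<in> {0..T}" for s
  proof -
    have "f s = ?g s * exp (2 * B * s)"
      by (simp add: mult.assoc flip: exp_add)
    also have "\<dots> \<le> ?g m * exp (2 * B * s)"
      using m(2)[OF that] by (intro mult_right_mono) auto
    finally show ?thesis .
  qed
  have "norm (integral {0..m} f) \<le> ?g m / (2 * B) * exp (2 * B * m)"
    using m nonneg B *
    by (intro norm_integral_exp_bound continuous_on_subset[OF cont]) auto
  also have "\<dots> = f m / (2 * B)"
    by (simp flip: exp_add)
  finally have "B * integral {0..m} f \<le> f m / 2"
    using B by (simp add: field_simps abs_le_iff)
  with le[OF m(1)] have fm: "f m \<le> 2 * c"
    by simp
  have "?g m \<le> f m * 1"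
    using m(1) B nonneg[OF m(1)] by (intro mult_left_mono) auto
  then have "?g m \<le> 2 * c"
    using fm by simp
  then have "?g m * exp (2 * B * t) \<le> 2 * c * exp (2 * B * t)"
    by (intro mult_right_mono) auto
  with *[OF t] show ?thesis
    by linarith
qed

section \<open>The initial value problem\<close>

text \<open>The second-order equation as a first-order system, with \<open>v\<close> in the role of
  \<open>u'\<close>. Derivatives are one-sided at the endpoints.\<close>

definition sl_sol :: "real \<Rightarrow> (real \<Rightarrow> real) \<Rightarrow> complex \<Rightarrow> (real \<Rightarrow> complex) \<Rightarrow> (real \<Rightarrow> complex) \<Rightarrow> bool"
  where "sl_sol T p lam u v \<longleftrightarrow> (\<forall>t\<in>{0..T}.
    (u has_vector_derivative v t) (at t within {0..T}) \<and>
    (v has_vector_derivative (of_real (p t) - lam) * u t) (at t within {0..T}))"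

section \<open>Uniqueness for the initial value problem\<close>

lemma sl_sol_continuous:
  assumes "sl_sol T p lam u v"
  shows "continuous_on {0..T} u" "continuous_on {0..T} v"
  using assms unfolding sl_sol_def
  by (auto intro!: has_vector_derivative_continuous simp: continuous_on_eq_continuous_within)

lemma bounded_on_interval:
  fixes p :: "real \<Rightarrow> 'a::real_normed_vector"
  assumes "continuous_on {0..T} p"
  obtains Q where "0 < Q" "\<And>t. t \<in> {0..T} \<Longrightarrow> norm (p t) \<le> Q"
proof -
  have "bounded (p ` {0..T})"
    by (intro compact_imp_bounded compact_continuous_image assms) auto
  then show ?thesis
    using that unfolding bounded_pos by auto
qed

lemma FTC_within:
  fixes f :: "real \<Rightarrow> 'a::banach"
  assumes "\<And>s. s \<in> {0..T} \<Longrightarrow> (f has_vector_derivative f' s) (at s within {0..T})" "t \<in> {0..T}"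
  shows "integral {0..t} f' = f t - f 0"
proof (intro integral_unique fundamental_theorem_of_calculus)
  fix s assume "s \<in> {0..t}"
  with assms(2) show "(f has_vector_derivative f' s) (at s within {0..t})"
    by (intro has_vector_derivative_within_subset[OF assms(1)]) auto
qed (use assms(2) in auto)

text \<open>Gronwall's inequality with \<open>c = 0\<close>, applied to
  \<open>norm (u t) + norm (v t)\<close>.\<close>

lemma sl_sol_zero:
  assumes p: "continuous_on {0..T} p" and s: "sl_sol T p lam u v" and "u 0 = 0" "v 0 = 0"
    and t: "t \<in> {0..T}"
  shows "u t = 0" "v t = 0"
proof -
  note cu = sl_sol_continuous[OF s]
  obtain Q where Q: "0 < Q" "\<And>t. t \<in> {0..T} \<Longrightarrow> norm (p t) \<le> Q"
    using bounded_on_interval[OF p] by blast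
  \<comment> \<open>The summand 1 lets a single constant dominate both coefficients of the system: 1
    in the equation for \<open>u\<close> and \<open>p - lam\<close> in the equation for
    \<open>v\<close>.\<close>
  define B where "B = Q + norm lam + 1"
  have B: "0 < B"
    using Q by (simp add: B_def add_pos_nonneg)
  define f where "f = (\<lambda>t. norm (u t) + norm (v t))"
  have cf: "continuous_on {0..T} f"
    unfolding f_def by (intro continuous_intros cu)
  have "f t \<le> 2 * 0 * exp (2 * B * t)"
  proof (rule gronwall_bound[OF cf _ B _ _ t])
    fix t assume t: "t \<in> {0..T}"
    have sub: "{0..t} \<subseteq> {0..T}"
      using t by auto
    note ct = continuous_on_subset[OF cu(1) sub] continuous_on_subset[OF cu(2) sub]
      continuous_on_subset[OF p sub]
    let ?g = "\<lambda>s. (of_real (p s) - lam) * u s"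
    have iu: "integral {0..t} v = u t" and iv: "integral {0..t} ?g = v t"
      using FTC_within[of T u v t] FTC_within[of T v ?g t] s t assms(3,4) by (auto simp: sl_sol_def)
    have "norm (u t) \<le> integral {0..t} (\<lambda>s. norm (v s))"
      unfolding iu[symmetric]
      by (intro integral_norm_bound_integral integrable_continuous_real continuous_intros ct) auto
    moreover have "norm (v t) \<le> integral {0..t} (\<lambda>s. (B - 1) * norm (u s))"
      unfolding iv[symmetric]
    proof (intro integral_norm_bound_integral integrable_continuous_real continuous_intros ct)
      fix s assume "s \<in> {0..t}"
      then have "norm (p s) \<le> Q"
        using t Q by auto
      then have "norm (of_real (p s) - lam) \<le> B - 1"
        using norm_triangle_ineq4[of "of_real (p s)" lam] by (simp add: B_def)
      then show "norm (?g s) \<le> (B - 1) * norm (u s)"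
        unfolding norm_mult by (intro mult_right_mono) auto
    qed
    ultimately have "f t \<le> integral {0..t} (\<lambda>s. norm (v s)) + integral {0..t} (\<lambda>s. (B - 1) * norm (u s))"
      by (simp add: f_def)
    also have "\<dots> = integral {0..t} (\<lambda>s. norm (v s) + (B - 1) * norm (u s))"
      by (intro integral_add[symmetric] integrable_continuous_real continuous_intros ct)
    also have "\<dots> \<le> integral {0..t} (\<lambda>s. B * f s)"
    proof (intro integral_le integrable_continuous_real continuous_intros ct continuous_on_subset[OF cf sub])
      fix s assume "s \<in> {0..t}"
      have "norm (v s) * 1 \<le> norm (v s) * B"
        using Q by (intro mult_left_mono) (auto simp: B_def)
      then show "norm (v s) + (B - 1) * norm (u s) \<le> B * f s"
        by (simp add: f_def algebra_simps add_increasing)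
    qed
    also have "\<dots> = B * integral {0..t} f"
      by simp
    finally show "f t \<le> 0 + B * integral {0..t} f"
      by simp
  qed (auto simp: f_def)
  then have "norm (u t) + norm (v t) \<le> 0"
    by (simp add: f_def)
  then have "norm (u t) = 0" "norm (v t) = 0"
    using norm_ge_zero[of "u t"] norm_ge_zero[of "v t"] by linarith+
  then show "u t = 0" "v t = 0"
    by auto
qed

text \<open>The factor \<open>c\<close> serves to recognise a solution with proportional initial
  data, such as an eigenfunction, as a multiple of the normalised one.\<close>

lemma sl_sol_unique:
  assumes p: "continuous_on {0..T} p" and s: "sl_sol T p lam u v" "sl_sol T p lam u' v'"
    and "u 0 = c * u' 0" "v 0 = c * v' 0" and t: "t \<in> {0..T}"
  shows "u t = c * u' t" "v t = c * v' t"
proof -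
  have "sl_sol T p lam (\<lambda>t. u t - c * u' t) (\<lambda>t. v t - c * v' t)"
    using s unfolding sl_sol_def
    by (auto intro!: derivative_eq_intros simp: algebra_simps)
  from sl_sol_zero[OF p this _ _ t] assms(4,5)
  show "u t = c * u' t" "v t = c * v' t"
    by auto
qed

section \<open>Existence: the Neumann series and its dependence on the spectral parameter\<close>

text \<open>The terms of the Neumann series, not its partial sums.\<close>

primrec picard :: "(real \<Rightarrow> real) \<Rightarrow> complex \<Rightarrow> nat \<Rightarrow> complex \<Rightarrow> real \<Rightarrow> complex \<times> complex" where
  "picard p h 0 lam = (\<lambda>t. (1, h))"
| "picard p h (Suc n) lam = (\<lambda>t. (integral {0..t} (\<lambda>s. snd (picard p h n lam s)),
     integral {0..t} (\<lambda>s. (of_real (p s) - lam) * fst (picard p h n lam s))))"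

text \<open>Polynomial dependence on the spectral parameter yields both joint continuity and
  holomorphy of the Neumann terms without differentiating under the integral.\<close>

definition poly_param :: "real \<Rightarrow> (complex \<Rightarrow> real \<Rightarrow> complex) \<Rightarrow> bool" where
  "poly_param T f \<longleftrightarrow> (\<exists>N c. (\<forall>k. continuous_on {0..T} (c k)) \<and>
     (\<forall>lam. \<forall>t\<in>{0..T}. f lam t = (\<Sum>k<N::nat. c k t * lam ^ k)))"

lemma poly_param_const: "poly_param T (\<lambda>lam t. c)"
  unfolding poly_param_def
  by (rule exI[of _ 1], rule exI[of _ "\<lambda>_ _. c"]) auto

lemma poly_param_integral:
  assumes "poly_param T f"
  shows "poly_param T (\<lambda>lam t. integral {0..t} (f lam))"
proof -
  obtain N c where c: "\<And>k. continuous_on {0..T} (c k)"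
    and f: "\<And>lam t. t \<in> {0..T} \<Longrightarrow> f lam t = (\<Sum>k<N. c k t * lam ^ k)"
    using assms unfolding poly_param_def by blast
  have "integral {0..t} (f lam) = (\<Sum>k<N. integral {0..t} (c k) * lam ^ k)" if t: "t \<in> {0..T}" for lam t
  proof -
    have "continuous_on {0..t} (c k)" for k
      using t by (intro continuous_on_subset[OF c]) auto
    then have ik: "(c k has_integral integral {0..t} (c k)) {0..t}" for k
      by (intro integrable_integral integrable_continuous_real)
    have "integral {0..t} (f lam) = integral {0..t} (\<lambda>s. \<Sum>k<N. c k s * lam ^ k)"
      using t f by (intro integral_cong) auto
    also have "\<dots> = (\<Sum>k<N. integral {0..t} (c k) * lam ^ k)"
      by (intro integral_unique has_integral_sum has_integral_mult_left ik) auto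
    finally show ?thesis .
  qed
  moreover have "continuous_on {0..T} (\<lambda>t. integral {0..t} (c k))" for k
    by (intro indefinite_integral_continuous_1 integrable_continuous_real c)
  ultimately show ?thesis
    unfolding poly_param_def by (intro exI[of _ N] exI[of _ "\<lambda>k t. integral {0..t} (c k)"]) auto
qed

lemma poly_param_mult:
  assumes "poly_param T f" and p: "continuous_on {0..T} p"
  shows "poly_param T (\<lambda>lam t. (of_real (p t) - lam) * f lam t)"
proof -
  obtain N c where c: "\<And>k. continuous_on {0..T} (c k)"
    and f: "\<And>lam t. t \<in> {0..T} \<Longrightarrow> f lam t = (\<Sum>k<N. c k t * lam ^ k)"
    using assms unfolding poly_param_def by blast
  \<comment> \<open>Multiplication by \<open>lam\<close> shifts the coefficients by one place, hence
    \<open>Suc N\<close> terms. The values \<open>c k\<close> with \<open>k \<ge> N\<close> are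
    arbitrary and have to be cut off.\<close>
  define d where "d = (\<lambda>k t. (if k < N then of_real (p t) * c k t else 0) -
    (case k of 0 \<Rightarrow> 0 | Suc j \<Rightarrow> c j t))"
  have "continuous_on {0..T} (d k)" for k
    unfolding d_def by (cases k; cases "k < N") (auto intro!: continuous_intros c p)
  moreover have "(of_real (p t) - lam) * f lam t = (\<Sum>k<Suc N. d k t * lam ^ k)" if "t \<in> {0..T}" for t lam
  proof -
    have "(\<Sum>k<Suc N. d k t * lam ^ k) =
      (\<Sum>k<Suc N. (if k < N then of_real (p t) * c k t else 0) * lam ^ k) -
      (\<Sum>k<Suc N. (case k of 0 \<Rightarrow> 0 | Suc j \<Rightarrow> c j t) * lam ^ k)"
      unfolding d_def by (simp only: left_diff_distrib sum_subtractf)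
    also have "\<dots> = (\<Sum>k<N. of_real (p t) * c k t * lam ^ k) - (\<Sum>k<N. c k t * lam ^ Suc k)"
      by (subst (2) sum.lessThan_Suc_shift) auto
    also have "\<dots> = (of_real (p t) - lam) * f lam t"
      unfolding f[OF that] left_diff_distrib sum_distrib_left by (simp add: mult_ac sum_subtractf)
    finally show ?thesis ..
  qed
  ultimately show ?thesis
    unfolding poly_param_def by (intro exI[of _ "Suc N"] exI[of _ d]) auto
qed

lemma poly_param_continuous:
  assumes "poly_param T f"
  shows "continuous_on (UNIV \<times> {0..T}) (\<lambda>(lam, t). f lam t)"
proof -
  obtain N c where c: "\<And>k. continuous_on {0..T} (c k)"
    and f: "\<And>lam t. t \<in> {0..T} \<Longrightarrow> f lam t = (\<Sum>k<N. c k t * lam ^ k)"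
    using assms unfolding poly_param_def by blast
  have "continuous_on (UNIV \<times> {0..T}) (\<lambda>x. c k (snd x))" for k
    by (rule continuous_on_compose2[OF c]) (auto intro!: continuous_intros)
  then have "continuous_on (UNIV \<times> {0..T}) (\<lambda>x::complex\<times>real. \<Sum>k<N. c k (snd x) * fst x ^ k)"
    by (intro continuous_intros)
  then show ?thesis
    by (rule continuous_on_eq) (auto simp: f)
qed

lemma poly_param_holomorphic:
  assumes "poly_param T f" "t \<in> {0..T}"
  shows "(\<lambda>lam. f lam t) holomorphic_on S"
proof -
  obtain N c where "\<And>lam. f lam t = (\<Sum>k<N. c k t * lam ^ k)"
    using assms unfolding poly_param_def by blast
  then show ?thesis
    by (simp add: holomorphic_intros)
qed

lemma poly_param_picard:
  assumes "continuous_on {0..T} p"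
  shows "poly_param T (\<lambda>lam t. fst (picard p h n lam t))"
    and "poly_param T (\<lambda>lam t. snd (picard p h n lam t))"
proof (induction n)
  case 0
  show "poly_param T (\<lambda>lam t. fst (picard p h 0 lam t))"
    and "poly_param T (\<lambda>lam t. snd (picard p h 0 lam t))"
    by (simp_all add: poly_param_const)
next
  case (Suc n)
  show "poly_param T (\<lambda>lam t. fst (picard p h (Suc n) lam t))"
    and "poly_param T (\<lambda>lam t. snd (picard p h (Suc n) lam t))"
    using Suc assms by (simp_all add: poly_param_integral poly_param_mult)
qed

lemma poly_param_continuous_slice:
  assumes "poly_param T f"
  shows "continuous_on {0..T} (f lam)"
proof -
  have "continuous_on {0..T} ((\<lambda>(lam, t). f lam t) \<circ> Pair lam)"
    by (intro continuous_on_compose continuous_on_subset[OF poly_param_continuous[OF assms]])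
       (auto intro!: continuous_intros)
  then show ?thesis
    by (simp add: o_def)
qed

text \<open>A Picard step integrates against \<open>exp (k * s)\<close>, which gains
  \<open>1 / k\<close>. The factor \<open>p - lam\<close> costs at most \<open>k / 2\<close>, and
  \<open>k\<close> is at least 2, so each step halves the bound, uniformly for \<open>lam\<close> in
  a ball of radius \<open>R\<close>.\<close>

lemma picard_bound:
  assumes p: "continuous_on {0..T} p" and Q: "0 < Q" "\<And>t. t \<in> {0..T} \<Longrightarrow> norm (p t) \<le> Q"
    and lam: "norm lam \<le> R" and t: "t \<in> {0..T}"
  defines "k \<equiv> 2 * (Q + R + 1)"
  shows "norm (fst (picard p h n lam t)) \<le> (1 + norm h) * (1 / 2) ^ n * exp (k * t) \<and>
    norm (snd (picard p h n lam t)) \<le> (1 + norm h) * (1 / 2) ^ n * exp (k * t)"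
proof -
  have R: "0 \<le> R"
    using lam norm_ge_zero order_trans by blast
  have k: "2 \<le> k"
    using Q R by (simp add: k_def)
  show ?thesis
    using t
  proof (induction n arbitrary: t)
    case 0
    have "1 \<le> exp (k * t)"
      using 0 k by simp
    then have le: "(1 + norm h) * 1 \<le> (1 + norm h) * exp (k * t)"
      by (intro mult_left_mono) auto
    have "1 \<le> (1 + norm h) * exp (k * t)"
      by (rule order_trans[OF _ le]) auto
    moreover have "norm h \<le> (1 + norm h) * exp (k * t)"
      by (rule order_trans[OF _ le]) auto
    ultimately show ?case
      by simp
  next
    case (Suc n)
    let ?C = "(1 + norm h) * (1 / 2) ^ n"
    let ?u = "\<lambda>s. fst (picard p h n lam s)" and ?v = "\<lambda>s. snd (picard p h n lam s)"
    have sub: "{0..t} \<subseteq> {0..T}"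
      using Suc.prems by auto
    note cs = poly_param_picard[OF p, of h n, THEN poly_param_continuous_slice, of lam,
        THEN continuous_on_subset, OF sub]
    have "norm (integral {0..t} ?v) \<le> ?C / k * exp (k * t)"
      using Suc k sub cs by (intro norm_integral_exp_bound) auto
    also have "\<dots> \<le> ?C / 2 * exp (k * t)"
      using k by (intro mult_right_mono divide_left_mono) auto
    finally have 1: "norm (integral {0..t} ?v) \<le> ?C / 2 * exp (k * t)" .
    have "norm (integral {0..t} (\<lambda>s. (of_real (p s) - lam) * ?u s)) \<le> ((k / 2) * ?C) / k * exp (k * t)"
    proof (intro norm_integral_exp_bound continuous_on_mult continuous_on_diff continuous_on_of_real
        continuous_on_const cs continuous_on_subset[OF p sub])
      fix s assume s: "s \<in> {0..t}"
      then have "norm (of_real (p s) - lam) \<le> Q + R"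
        using norm_triangle_ineq4[of "of_real (p s)" lam] Q(2)[of s] lam Suc.prems by auto
      then have "norm (of_real (p s) - lam) \<le> k / 2"
        by (simp add: k_def)
      moreover have "norm (?u s) \<le> ?C * exp (k * s)"
        using Suc s by auto
      ultimately have "norm (of_real (p s) - lam) * norm (?u s) \<le> k / 2 * (?C * exp (k * s))"
        using k by (intro mult_mono) auto
      then show "norm ((of_real (p s) - lam) * ?u s) \<le> (k / 2) * ?C * exp (k * s)"
        by (simp add: norm_mult mult.assoc)
    qed (use k Suc.prems in auto)
    also have "\<dots> = ?C / 2 * exp (k * t)"
      using k by simp
    finally show ?case
      using 1 by (simp add: mult_ac)
  qed
qed

section \<open>The sum of the Neumann series: regularity and differential equation\<close>

definition sl_u :: "(real \<Rightarrow> real) \<Rightarrow> complex \<Rightarrow> complex \<Rightarrow> real \<Rightarrow> complex" where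
  "sl_u p h lam t = (\<Sum>n. fst (picard p h n lam t))"

definition sl_v :: "(real \<Rightarrow> real) \<Rightarrow> complex \<Rightarrow> complex \<Rightarrow> real \<Rightarrow> complex" where
  "sl_v p h lam t = (\<Sum>n. snd (picard p h n lam t))"

text \<open>Weierstrass test with the geometric majorant from \<open>picard_bound\<close>.
  Uniformity holds jointly in \<open>lam\<close> and \<open>t\<close>, so that slices in either
  variable inherit it.\<close>

lemma picard_uniform:
  assumes p: "continuous_on {0..T} p"
  shows "uniform_limit (cball 0 R \<times> {0..T})
      (\<lambda>N x. \<Sum>n<N. fst (picard p h n (fst x) (snd x))) (\<lambda>x. sl_u p h (fst x) (snd x)) sequentially"
    and "uniform_limit (cball 0 R \<times> {0..T})
      (\<lambda>N x. \<Sum>n<N. snd (picard p h n (fst x) (snd x))) (\<lambda>x. sl_v p h (fst x) (snd x)) sequentially"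
proof -
  obtain Q where Q: "0 < Q" "\<And>t. t \<in> {0..T} \<Longrightarrow> norm (p t) \<le> Q"
    using bounded_on_interval[OF p] by blast
  define k where "k = 2 * (Q + R + 1)"
  define M where "M = (\<lambda>n. ((1 + norm h) * exp (k * T)) * (1 / 2) ^ n)"
  have M: "summable M"
    unfolding M_def by (intro summable_mult summable_geometric) auto
  have "norm (fst (picard p h n lam t)) \<le> M n \<and> norm (snd (picard p h n lam t)) \<le> M n"
    if "norm lam \<le> R" "t \<in> {0..T}" for n lam t
  proof -
    have "0 \<le> R"
      using that(1) norm_ge_zero order_trans by blast
    then have "exp (k * t) \<le> exp (k * T)"
      using that Q by (auto simp: k_def intro!: mult_left_mono)
    then have "(1 + norm h) * (1 / 2) ^ n * exp (k * t) \<le> (1 + norm h) * (1 / 2) ^ n * exp (k * T)"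
      by (intro mult_left_mono) auto
    then show ?thesis
      using picard_bound[OF p Q that, of h n] by (simp add: M_def k_def mult_ac)
  qed
  then show "uniform_limit (cball 0 R \<times> {0..T})
      (\<lambda>N x. \<Sum>n<N. fst (picard p h n (fst x) (snd x))) (\<lambda>x. sl_u p h (fst x) (snd x)) sequentially"
    and "uniform_limit (cball 0 R \<times> {0..T})
      (\<lambda>N x. \<Sum>n<N. snd (picard p h n (fst x) (snd x))) (\<lambda>x. sl_v p h (fst x) (snd x)) sequentially"
    unfolding sl_u_def sl_v_def
    by (auto intro!: Weierstrass_m_test[OF _ M])
qed

text \<open>Joint continuity later permits the limit in \<open>lam\<close> under the norming
  integral.\<close>

lemma sl_u_joint_continuous:
  assumes p: "continuous_on {0..T} p"
  shows "continuous_on (cball 0 R \<times> {0..T}) (\<lambda>(lam, t). sl_u p h lam t)"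
proof -
  have "continuous_on (cball 0 R \<times> {0..T}) (\<lambda>x. fst (picard p h n (fst x) (snd x)))" for n
    using continuous_on_subset[OF poly_param_continuous[OF poly_param_picard(1)[OF p, of h n]],
        of "cball 0 R \<times> {0..T}"]
    by (auto simp: case_prod_unfold)
  then show ?thesis
    unfolding case_prod_unfold
    by (intro uniform_limit_theorem[OF _ picard_uniform(1)[OF p]])
       (auto intro!: always_eventually continuous_on_sum)
qed

lemma picard_uniform_slice:
  assumes p: "continuous_on {0..T} p"
  shows "uniform_limit {0..T} (\<lambda>N t. \<Sum>n<N. fst (picard p h n lam t)) (sl_u p h lam) sequentially"
    and "uniform_limit {0..T} (\<lambda>N t. \<Sum>n<N. snd (picard p h n lam t)) (sl_v p h lam) sequentially"
proof -
  have "(\<lambda>t. (lam, t)) \<in> {0..T} \<rightarrow> cball 0 (norm lam) \<times> {0..T}"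
    by auto
  then show "uniform_limit {0..T} (\<lambda>N t. \<Sum>n<N. fst (picard p h n lam t)) (sl_u p h lam) sequentially"
    and "uniform_limit {0..T} (\<lambda>N t. \<Sum>n<N. snd (picard p h n lam t)) (sl_v p h lam) sequentially"
    using uniform_limit_compose'[OF picard_uniform(1)[OF p], of "\<lambda>t. (lam, t)" "{0..T}" "norm lam" h]
      uniform_limit_compose'[OF picard_uniform(2)[OF p], of "\<lambda>t. (lam, t)" "{0..T}" "norm lam" h]
    by auto
qed

text \<open>The partial sums are polynomials in \<open>lam\<close> that converge uniformly on every
  unit ball.\<close>

lemma sl_uv_holomorphic:
  assumes p: "continuous_on {0..T} p" and t: "t \<in> {0..T}"
  shows "(\<lambda>lam. sl_u p h lam t) holomorphic_on UNIV" "(\<lambda>lam. sl_v p h lam t) holomorphic_on UNIV"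
proof -
  have u: "uniform_limit (cball z 1) (\<lambda>N lam. \<Sum>n<N. fst (picard p h n lam t)) (\<lambda>lam. sl_u p h lam t) sequentially"
    "uniform_limit (cball z 1) (\<lambda>N lam. \<Sum>n<N. snd (picard p h n lam t)) (\<lambda>lam. sl_v p h lam t) sequentially" for z
  proof -
    have "cball z 1 \<subseteq> cball 0 (norm z + 1)"
      by (simp add: cball_subset_cball_iff)
    then have "(\<lambda>lam. (lam, t)) \<in> cball z 1 \<rightarrow> cball 0 (norm z + 1) \<times> {0..T}"
      using t by auto
    then show "uniform_limit (cball z 1) (\<lambda>N lam. \<Sum>n<N. fst (picard p h n lam t)) (\<lambda>lam. sl_u p h lam t) sequentially"
      "uniform_limit (cball z 1) (\<lambda>N lam. \<Sum>n<N. snd (picard p h n lam t)) (\<lambda>lam. sl_v p h lam t) sequentially"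
      using uniform_limit_compose'[OF picard_uniform(1)[OF p], of "\<lambda>lam. (lam, t)" "cball z 1" "norm z + 1" h]
        uniform_limit_compose'[OF picard_uniform(2)[OF p], of "\<lambda>lam. (lam, t)" "cball z 1" "norm z + 1" h]
      by auto
  qed
  note hol = poly_param_picard[OF p, THEN poly_param_holomorphic, OF t]
  show "(\<lambda>lam. sl_u p h lam t) holomorphic_on UNIV"
  proof (rule holomorphic_uniform_sequence)
    show "(\<lambda>lam. \<Sum>n<N. fst (picard p h n lam t)) holomorphic_on UNIV" for N
      by (intro holomorphic_intros hol)
  qed (use u in \<open>auto intro!: exI[of _ "1::real"]\<close>)
  show "(\<lambda>lam. sl_v p h lam t) holomorphic_on UNIV"
  proof (rule holomorphic_uniform_sequence)
    show "(\<lambda>lam. \<Sum>n<N. snd (picard p h n lam t)) holomorphic_on UNIV" for N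
      by (intro holomorphic_intros hol)
  qed (use u in \<open>auto intro!: exI[of _ "1::real"]\<close>)
qed

lemma sl_uv_continuous:
  assumes p: "continuous_on {0..T} p"
  shows "continuous_on {0..T} (sl_u p h lam)" "continuous_on {0..T} (sl_v p h lam)"
proof -
  note cs = poly_param_picard[OF p, THEN poly_param_continuous_slice]
  show "continuous_on {0..T} (sl_u p h lam)"
    by (rule uniform_limit_theorem[OF _ picard_uniform_slice(1)[OF p]])
       (auto intro!: always_eventually continuous_on_sum cs)
  show "continuous_on {0..T} (sl_v p h lam)"
    by (rule uniform_limit_theorem[OF _ picard_uniform_slice(2)[OF p]])
       (auto intro!: always_eventually continuous_on_sum cs)
qed

text \<open>The recursion shifts the index: the partial sum of \<open>Suc N\<close> terms is the
  initial value plus an integral over the partial sum of \<open>N\<close> terms. Uniform convergence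
  passes through the integral.\<close>

lemma sl_uv_integral_equations:
  assumes p: "continuous_on {0..T} p" and t: "t \<in> {0..T}"
  shows "sl_u p h lam t = 1 + integral {0..t} (sl_v p h lam)"
    and "sl_v p h lam t = h + integral {0..t} (\<lambda>s. (of_real (p s) - lam) * sl_u p h lam s)"
proof -
  have sub: "{0..t} \<subseteq> {0..T}"
    using t by auto
  note cs = poly_param_picard[OF p, THEN poly_param_continuous_slice, THEN continuous_on_subset, OF sub]
  note pt = continuous_on_subset[OF p sub]
  define SU where "SU = (\<lambda>N s. \<Sum>n<N. fst (picard p h n lam s))"
  define SV where "SV = (\<lambda>N s. \<Sum>n<N. snd (picard p h n lam s))"
  have cSU: "continuous_on {0..t} (SU N)" and cSV: "continuous_on {0..t} (SV N)" for N
    unfolding SU_def SV_def by (intro continuous_intros cs)+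
  have uU: "uniform_limit {0..t} SU (sl_u p h lam) sequentially"
    and uV: "uniform_limit {0..t} SV (sl_v p h lam) sequentially"
    unfolding SU_def SV_def by (intro uniform_limit_on_subset[OF _ sub] picard_uniform_slice p)+
  have limU: "(\<lambda>N. SU N t) \<longlonglongrightarrow> sl_u p h lam t" and limV: "(\<lambda>N. SV N t) \<longlonglongrightarrow> sl_v p h lam t"
    using tendsto_uniform_limitI[OF uU, of t] tendsto_uniform_limitI[OF uV, of t] t by auto
  have "SU (Suc N) t = 1 + integral {0..t} (SV N)" for N
    unfolding SU_def SV_def
    by (subst sum.lessThan_Suc_shift, subst integral_sum) (auto intro!: integrable_continuous_real cs)
  moreover have "(\<lambda>N. integral {0..t} (SV N)) \<longlonglongrightarrow> integral {0..t} (sl_v p h lam)"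
    by (intro uniform_limit_integral_tendsto uV cSV)
  ultimately have "(\<lambda>N. SU (Suc N) t) \<longlonglongrightarrow> 1 + integral {0..t} (sl_v p h lam)"
    by (auto intro!: tendsto_intros)
  with limU show "sl_u p h lam t = 1 + integral {0..t} (sl_v p h lam)"
    using LIMSEQ_Suc LIMSEQ_unique by blast

  let ?m = "\<lambda>s. of_real (p s) - lam"
  have "SV (Suc N) t = h + integral {0..t} (\<lambda>s. ?m s * SU N s)" for N
    unfolding SU_def SV_def sum_distrib_left
    by (subst sum.lessThan_Suc_shift, subst integral_sum)
       (auto intro!: integrable_continuous_real cs continuous_intros pt)
  moreover
  have "uniform_limit {0..t} (\<lambda>N s. ?m s * SU N s) (\<lambda>s. ?m s * sl_u p h lam s) sequentially"
  proof (rule uniform_lim_mult[OF uniform_limit_const uU])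
    have "continuous_on {0..t} ?m" "continuous_on {0..t} (sl_u p h lam)"
      by (intro continuous_intros pt continuous_on_subset[OF _ sub] sl_uv_continuous p)+
    then show "bounded (?m ` {0..t})" "bounded (sl_u p h lam ` {0..t})"
      by (auto intro!: compact_imp_bounded compact_continuous_image)
  qed
  then have "(\<lambda>N. integral {0..t} (\<lambda>s. ?m s * SU N s)) \<longlonglongrightarrow> integral {0..t} (\<lambda>s. ?m s * sl_u p h lam s)"
    by (rule uniform_limit_integral_tendsto) (intro continuous_intros cSU pt)
  ultimately have "(\<lambda>N. SV (Suc N) t) \<longlonglongrightarrow> h + integral {0..t} (\<lambda>s. ?m s * sl_u p h lam s)"
    by (auto intro!: tendsto_intros)
  with limV show "sl_v p h lam t = h + integral {0..t} (\<lambda>s. ?m s * sl_u p h lam s)"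
    using LIMSEQ_Suc LIMSEQ_unique by blast
qed

lemma sl_uv_sol:
  assumes p: "continuous_on {0..T} p"
  shows "sl_sol T p lam (sl_u p h lam) (sl_v p h lam)"
  unfolding sl_sol_def
proof (intro ballI conjI)
  fix t assume t: "t \<in> {0..T}"
  let ?g = "\<lambda>s. (of_real (p s) - lam) * sl_u p h lam s"
  have "((\<lambda>t. 1 + integral {0..t} (sl_v p h lam)) has_vector_derivative 0 + sl_v p h lam t) (at t within {0..T})"
    by (intro has_vector_derivative_add has_vector_derivative_const
        integral_has_vector_derivative sl_uv_continuous p t)
  then show "(sl_u p h lam has_vector_derivative sl_v p h lam t) (at t within {0..T})"
    using t by (auto intro: has_vector_derivative_transform simp: sl_uv_integral_equations(1)[OF p])
  have "((\<lambda>t. h + integral {0..t} ?g) has_vector_derivative 0 + ?g t) (at t within {0..T})"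
    by (intro has_vector_derivative_add has_vector_derivative_const
        integral_has_vector_derivative continuous_intros sl_uv_continuous p t)
  then show "(sl_v p h lam has_vector_derivative ?g t) (at t within {0..T})"
    using t by (auto intro: has_vector_derivative_transform[of t _ _ "\<lambda>t. h + integral {0..t} ?g"] simp: sl_uv_integral_equations(2)[OF p])
qed

lemma sl_uv_0:
  assumes "continuous_on {0..T} p" "0 \<le> T"
  shows "sl_u p h lam 0 = 1" "sl_v p h lam 0 = h"
  using sl_uv_integral_equations[OF assms(1), of 0 h lam] assms(2) by auto

section \<open>Asymptotics in the spectral parameter\<close>

lemma norm_cos_le_exp: "norm (cos z) \<le> exp \<bar>Im z\<bar>"
  and norm_sin_le_exp: "norm (sin z) \<le> exp \<bar>Im z\<bar>" for z :: complex
  using cmod_cos_le_exp[of 1 z] cmod_sin_le_exp[of 1 z] by auto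

lemma sl_sol_variation_of_constants:
  assumes s: "sl_sol T p (r\<^sup>2) u v" and r: "r \<noteq> 0" and t: "t \<in> {0..T}"
  shows "u t = cos (r * t) * u 0 + sin (r * t) / r * v 0 +
      integral {0..t} (\<lambda>s. sin (r * (of_real t - of_real s)) * (of_real (p s) * u s)) / r"
    and "v t = - r * sin (r * t) * u 0 + cos (r * t) * v 0 +
      integral {0..t} (\<lambda>s. cos (r * (of_real t - of_real s)) * (of_real (p s) * u s))"
proof -
  have du: "(u has_vector_derivative v s) (at s within {0..t})"
    and dv: "(v has_vector_derivative (of_real (p s) - r\<^sup>2) * u s) (at s within {0..t})"
    if "s \<in> {0..t}" for s
    using s t that unfolding sl_sol_def
    by (auto intro: has_vector_derivative_within_subset[where S = "{0..T}"])
  have dc: "((\<lambda>s. cos (r * (of_real t - of_real s))) has_vector_derivative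
      r * sin (r * (of_real t - of_real s))) (at s within {0..t})"
    and ds: "((\<lambda>s. sin (r * (of_real t - of_real s))) has_vector_derivative
      - r * cos (r * (of_real t - of_real s))) (at s within {0..t})" for s
    by (rule has_vector_derivative_real_field; auto intro!: derivative_eq_intros)+
  \<comment> \<open>With \<open>t\<close> fixed, this function of \<open>s\<close> is
    \<open>u t\<close> at \<open>s = t\<close> and the solution of the free equation at
    \<open>s = 0\<close>. In its derivative everything but the potential term cancels.\<close>
  have "((\<lambda>s. cos (r * (of_real t - of_real s)) * u s + sin (r * (of_real t - of_real s)) * (v s / r))
      has_vector_derivative (sin (r * (of_real t - of_real s)) * (of_real (p s) * u s)) / r) (at s within {0..t})"
    if "s \<in> {0..t}" for s
    by (rule derivative_eq_intros dc ds du dv that refl)+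
       (use r in \<open>simp add: field_simps power2_eq_square\<close>)
  from FTC_within[OF this, of t] t
  show "u t = cos (r * t) * u 0 + sin (r * t) / r * v 0 +
      integral {0..t} (\<lambda>s. sin (r * (of_real t - of_real s)) * (of_real (p s) * u s)) / r"
    by (simp add: algebra_simps)
  have "((\<lambda>s. - r * (sin (r * (of_real t - of_real s)) * u s) + cos (r * (of_real t - of_real s)) * v s)
      has_vector_derivative cos (r * (of_real t - of_real s)) * (of_real (p s) * u s)) (at s within {0..t})"
    if "s \<in> {0..t}" for s
    by (rule derivative_eq_intros dc ds du dv that refl)+
       (simp add: algebra_simps power2_eq_square)
  from FTC_within[OF this, of t] t
  show "v t = - r * sin (r * t) * u 0 + cos (r * t) * v 0 +
      integral {0..t} (\<lambda>s. cos (r * (of_real t - of_real s)) * (of_real (p s) * u s))"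
    by (simp add: algebra_simps)
qed

text \<open>The general kernel \<open>g\<close> covers sine and cosine at once. Splitting
  \<open>exp (\<bar>Im r\<bar> * (t - s))\<close> moves the growth in \<open>t\<close> out of the
  integral and leaves a decaying weight on \<open>u\<close>.\<close>

lemma norm_oscillating_integral_le:
  fixes g :: "complex \<Rightarrow> complex"
  assumes g: "\<And>z. norm (g z) \<le> exp \<bar>Im z\<bar>" "continuous_on UNIV g"
    and p: "continuous_on {0..T} p" and Q: "\<And>t. t \<in> {0..T} \<Longrightarrow> norm (p t) \<le> Q"
    and u: "continuous_on {0..T} u" and t: "t \<in> {0..T}"
  shows "norm (integral {0..t} (\<lambda>s. g (r * (of_real t - of_real s)) * (of_real (p s) * u s)))
    \<le> exp (\<bar>Im r\<bar> * t) * (Q * integral {0..t} (\<lambda>s. norm (u s) * exp (- \<bar>Im r\<bar> * s)))"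
proof -
  have sub: "{0..t} \<subseteq> {0..T}"
    using t by auto
  note c = continuous_on_subset[OF p sub] continuous_on_subset[OF u sub]
  have "norm (integral {0..t} (\<lambda>s. g (r * (of_real t - of_real s)) * (of_real (p s) * u s)))
    \<le> integral {0..t} (\<lambda>s. exp (\<bar>Im r\<bar> * t) * (Q * (norm (u s) * exp (- \<bar>Im r\<bar> * s))))"
  proof (intro integral_norm_bound_integral integrable_continuous_real continuous_intros c
      continuous_on_compose2[OF g(2)])
    fix s assume s: "s \<in> {0..t}"
    have "norm (g (r * (of_real t - of_real s))) \<le> exp \<bar>Im (r * (of_real t - of_real s))\<bar>"
      by (rule g)
    also have "\<bar>Im (r * (of_real t - of_real s))\<bar> = \<bar>Im r\<bar> * (t - s)"
      using s by (simp flip: of_real_diff add: abs_mult)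
    finally have "norm (g (r * (of_real t - of_real s))) * (norm (p s) * norm (u s))
        \<le> exp (\<bar>Im r\<bar> * (t - s)) * (Q * norm (u s))"
      using Q[of s] s t by (intro mult_mono mult_nonneg_nonneg) (auto intro: order_trans[OF abs_ge_zero])
    then show "norm (g (r * (of_real t - of_real s)) * (of_real (p s) * u s))
      \<le> exp (\<bar>Im r\<bar> * t) * (Q * (norm (u s) * exp (- \<bar>Im r\<bar> * s)))"
      by (simp add: norm_mult right_diff_distrib exp_diff exp_minus field_simps)
  qed auto
  then show ?thesis
    by simp
qed

text \<open>Variation of constants leaves a remainder that is harmless once
  \<open>norm (u t) * exp (- \<bar>Im r\<bar> * t)\<close> is bounded independently of
  \<open>r\<close>. Gronwall's inequality provides that bound.\<close>

lemma sl_uv_asymptotics: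
  assumes p: "continuous_on {0..T} p" and T: "0 < T"
  obtains K where "0 < K"
    "\<And>r t. 1 \<le> norm r \<Longrightarrow> t \<in> {0..T} \<Longrightarrow>
      norm (sl_u p h (r\<^sup>2) t - cos (r * t)) \<le> K * exp (\<bar>Im r\<bar> * t) / norm r"
    "\<And>r t. 1 \<le> norm r \<Longrightarrow> t \<in> {0..T} \<Longrightarrow>
      norm (sl_v p h (r\<^sup>2) t + r * sin (r * t)) \<le> K * exp (\<bar>Im r\<bar> * t)"
proof -
  obtain Q where Q: "0 < Q" "\<And>t. t \<in> {0..T} \<Longrightarrow> norm (p t) \<le> Q"
    using bounded_on_interval[OF p] by blast
  \<comment> \<open>\<open>M\<close> is the Gronwall bound for the weighted function
    \<open>f\<close> below, with constants \<open>1 + norm h\<close> and \<open>Q\<close>.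
    \<open>K\<close> adds the contribution of the initial slope \<open>h\<close> and that of the
    integral remainder.\<close>
  define M where "M = 2 * (1 + norm h) * exp (2 * Q * T)"
  define K where "K = norm h + Q * (M * T)"
  have "0 < M"
    by (simp add: M_def add_pos_nonneg)
  then have K: "0 < K"
    using Q T by (simp add: K_def add_nonneg_pos)
  have main: "norm (sl_u p h (r\<^sup>2) t - cos (r * t)) \<le> K * exp (\<bar>Im r\<bar> * t) / norm r \<and>
      norm (sl_v p h (r\<^sup>2) t + r * sin (r * t)) \<le> K * exp (\<bar>Im r\<bar> * t)"
    if r: "1 \<le> norm r" and t: "t \<in> {0..T}" for r t
  proof -
    let ?u = "sl_u p h (r\<^sup>2)" and ?v = "sl_v p h (r\<^sup>2)" and ?\<tau> = "\<bar>Im r\<bar>"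
    have r0: "r \<noteq> 0"
      using r by auto
    note s = sl_uv_sol[OF p, of "r\<^sup>2" h]
    note cu = sl_sol_continuous(1)[OF s]
    let ?S = "\<lambda>t. integral {0..t} (\<lambda>s. sin (r * (of_real t - of_real s)) * (of_real (p s) * ?u s))"
    let ?C = "\<lambda>t. integral {0..t} (\<lambda>s. cos (r * (of_real t - of_real s)) * (of_real (p s) * ?u s))"
    have u_eq: "?u t = cos (r * t) + sin (r * t) / r * h + ?S t / r"
      and v_eq: "?v t = - r * sin (r * t) + cos (r * t) * h + ?C t" if "t \<in> {0..T}" for t
      using sl_sol_variation_of_constants[OF s r0 that] T sl_uv_0[OF p] by simp_all
    define f where "f = (\<lambda>t. norm (?u t) * exp (- ?\<tau> * t))"
    have cf: "continuous_on {0..T} f"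
      unfolding f_def by (intro continuous_intros cu)
    have S: "norm (?S t) \<le> exp (?\<tau> * t) * (Q * integral {0..t} f)"
      and C: "norm (?C t) \<le> exp (?\<tau> * t) * (Q * integral {0..t} f)" if "t \<in> {0..T}" for t
      unfolding f_def
      by (intro norm_oscillating_integral_le[OF _ _ p Q(2) cu that] norm_cos_le_exp norm_sin_le_exp
          continuous_intros; simp)+
    have cs: "norm (cos (r * t)) \<le> exp (?\<tau> * t)" "norm (sin (r * t)) \<le> exp (?\<tau> * t)"
      if "t \<in> {0..T}" for t
      using norm_cos_le_exp[of "r * t"] norm_sin_le_exp[of "r * t"] that by (auto simp: abs_mult)
    have div_r: "x / norm r \<le> x" if "0 \<le> x" for x
      using that r by (simp add: divide_le_eq mult_le_cancel_left1)
    have f_le: "f t \<le> M" if t: "t \<in> {0..T}" for t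
    proof -
      have "f t \<le> 2 * (1 + norm h) * exp (2 * Q * t)"
      proof (rule gronwall_bound[OF cf _ Q(1) _ _ t])
        fix t assume t: "t \<in> {0..T}"
        have "norm (?u t) \<le> norm (cos (r * t)) + norm (sin (r * t)) / norm r * norm h + norm (?S t) / norm r"
          unfolding u_eq[OF t]
          by (intro order_trans[OF norm_triangle_ineq] add_mono) (auto simp: norm_mult norm_divide)
        also have "\<dots> \<le> exp (?\<tau> * t) + exp (?\<tau> * t) * norm h + exp (?\<tau> * t) * (Q * integral {0..t} f)"
          using cs[OF t] div_r[of "norm (sin (r * t))"] div_r[of "norm (?S t)"] S[OF t]
          by (intro add_mono mult_right_mono) auto
        also have "\<dots> = exp (?\<tau> * t) * (1 + norm h + Q * integral {0..t} f)"
          by (simp add: algebra_simps)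
        finally show "f t \<le> 1 + norm h + Q * integral {0..t} f"
          by (simp add: f_def exp_minus field_simps)
      qed (auto simp: f_def)
      also have "\<dots> \<le> M"
        unfolding M_def using t Q by (intro mult_left_mono) auto
      finally show ?thesis .
    qed
    have "integral {0..t} f \<le> integral {0..t} (\<lambda>s. M)"
      using t f_le by (intro integral_le integrable_continuous_real continuous_on_subset[OF cf]) auto
    also have "\<dots> \<le> M * T"
      using t \<open>0 < M\<close> by (simp add: mult.commute)
    finally have "exp (?\<tau> * t) * (Q * integral {0..t} f) \<le> exp (?\<tau> * t) * (Q * (M * T))"
      using Q by (intro mult_left_mono) auto
    then have S': "norm (?S t) \<le> exp (?\<tau> * t) * (Q * (M * T))"
      and C': "norm (?C t) \<le> exp (?\<tau> * t) * (Q * (M * T))"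
      using S[OF t] C[OF t] by linarith+
    have "?u t - cos (r * t) = (sin (r * t) * h + ?S t) / r"
      unfolding u_eq[OF t] by (simp add: add_divide_distrib)
    then have "norm (?u t - cos (r * t)) \<le> (norm (sin (r * t)) * norm h + norm (?S t)) / norm r"
      using norm_triangle_ineq[of "sin (r * t) * h" "?S t"]
      by (simp add: norm_divide norm_mult divide_right_mono)
    also have "\<dots> \<le> (exp (?\<tau> * t) * norm h + exp (?\<tau> * t) * (Q * (M * T))) / norm r"
      using cs[OF t] S' by (intro divide_right_mono add_mono mult_right_mono) auto
    also have "\<dots> = K * exp (?\<tau> * t) / norm r"
      by (simp add: K_def algebra_simps)
    finally have 1: "norm (?u t - cos (r * t)) \<le> K * exp (?\<tau> * t) / norm r" .
    have "norm (?v t + r * sin (r * t)) \<le> norm (cos (r * t)) * norm h + norm (?C t)"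
      unfolding v_eq[OF t] using norm_triangle_ineq[of "cos (r * t) * h" "?C t"]
      by (simp add: norm_mult)
    also have "\<dots> \<le> exp (?\<tau> * t) * norm h + exp (?\<tau> * t) * (Q * (M * T))"
      using cs[OF t] C' by (intro add_mono mult_right_mono) auto
    also have "\<dots> = K * exp (?\<tau> * t)"
      by (simp add: K_def algebra_simps)
    finally show ?thesis
      using 1 by simp
  qed
  show ?thesis
    using that[OF K] main by blast
qed

text \<open>The circles pass halfway between the zeros of the sine. Far from the real axis one
  exponential of the sine dominates the other. Near the axis the real part is close to plus or minus
  \<open>(n + 1 / 2) * pi\<close>, where the sine has modulus 1.\<close>

lemma norm_sin_lower_bound:
  obtains c where "0 < c"
    "\<And>(n::nat) z::complex. 1 \<le> n \<Longrightarrow> norm z = (of_nat n + 1 / 2) * pi \<Longrightarrow> c * exp \<bar>Im z\<bar> \<le> norm (sin z)"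
proof -
  \<comment> \<open>The entries of the minimum serve the cases \<open>\<bar>Im z\<bar> > 1\<close>
    and \<open>\<bar>Im z\<bar> \<le> 1\<close>. In the latter, \<open>exp (- 1)\<close> absorbs
    \<open>exp \<bar>Im z\<bar>\<close>.\<close>
  define c :: real where "c = min (1 / 4) (cos 1 * exp (- 1))"
  have c1: "0 < cos (1::real)"
    using pi_gt3 by (intro cos_gt_zero) auto
  then have c: "0 < c"
    by (simp add: c_def)
  moreover have "c * exp \<bar>Im z\<bar> \<le> norm (sin z)"
    if n: "1 \<le> n" and z: "norm z = (of_nat n + 1 / 2) * pi" for n :: nat and z :: complex
  proof (cases "\<bar>Im z\<bar> \<le> 1")
    case False
    have "norm (sin z) = norm (exp (\<i> * z) - exp (- (\<i> * z))) / 2"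
      by (simp add: sin_exp_eq norm_divide norm_mult)
    moreover have "\<bar>norm (exp (\<i> * z)) - norm (exp (- (\<i> * z)))\<bar> \<le> norm (exp (\<i> * z) - exp (- (\<i> * z)))"
      by (rule norm_triangle_ineq3)
    ultimately have *: "\<bar>exp (- Im z) - exp (Im z)\<bar> / 2 \<le> norm (sin z)"
      by simp
    have e: "exp (- \<bar>Im z\<bar>) \<le> exp \<bar>Im z\<bar> / 2"
    proof -
      have "1 + \<bar>Im z\<bar> \<le> exp \<bar>Im z\<bar>" by (rule exp_ge_add_one_self)
      then have "2 \<le> exp \<bar>Im z\<bar>" using False by linarith
      moreover have "exp (- \<bar>Im z\<bar>) \<le> 1" by simp
      ultimately show ?thesis by linarith
    qed
    have "\<bar>exp (- Im z) - exp (Im z)\<bar> = exp \<bar>Im z\<bar> - exp (- \<bar>Im z\<bar>)"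
      by (cases "0 \<le> Im z") auto
    then have "exp \<bar>Im z\<bar> / 4 \<le> norm (sin z)"
      using * e by simp
    moreover have "c * exp \<bar>Im z\<bar> \<le> 1 / 4 * exp \<bar>Im z\<bar>"
      by (intro mult_right_mono) (auto simp: c_def)
    ultimately show ?thesis
      by linarith
  next
    case True
    let ?x = "\<bar>Re z\<bar>"
    define R where "R = (of_nat n + 1 / 2) * pi"
    have R: "1 \<le> R"
    proof -
      have "1 * 1 \<le> R"
        unfolding R_def using pi_gt3 n by (intro mult_mono) auto
      then show ?thesis by simp
    qed
    have xR: "?x \<le> R"
      using abs_Re_le_cmod[of z] z by (simp add: R_def)
    have "?x\<^sup>2 + (Im z)\<^sup>2 = R\<^sup>2"
      using cmod_power2[of z] z by (simp add: R_def)
    moreover have "(Im z)\<^sup>2 \<le> 1"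
      using True by (simp add: abs_square_le_1)
    ultimately have "R\<^sup>2 - ?x\<^sup>2 \<le> 1"
      by linarith
    then have le: "(R - ?x) * (R + ?x) \<le> 1"
      by (simp add: power2_eq_square algebra_simps)
    \<comment> \<open>Since \<open>R + ?x\<close> is at least 1, the bound on the difference of
      squares is also one on \<open>R - ?x\<close>.\<close>
    have "(R - ?x) * 1 \<le> (R - ?x) * (R + ?x)"
      using R xR by (intro mult_left_mono) auto
    from order_trans[OF this le] have d: "0 \<le> R - ?x" "R - ?x \<le> 1"
      using xR by simp_all
    have "\<bar>sin ?x\<bar> = \<bar>sin (R - (R - ?x))\<bar>"
      by simp
    also have "\<dots> = \<bar>sin R * cos (R - ?x) - cos R * sin (R - ?x)\<bar>"
      by (simp only: sin_diff)
    also have "cos R = 0"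
      by (simp add: R_def distrib_right cos_add)
    also have "sin R = (- 1) ^ n"
      by (simp add: R_def distrib_right sin_add)
    finally have "\<bar>sin ?x\<bar> = \<bar>cos (R - ?x)\<bar>"
      by (simp add: abs_mult)
    moreover have "cos 1 \<le> cos (R - ?x)"
      using d pi_gt3 by (intro cos_monotone_0_pi_le) auto
    moreover have "\<bar>sin ?x\<bar> = \<bar>sin (Re z)\<bar>"
      by (cases "0 \<le> Re z") auto
    ultimately have s: "cos 1 \<le> \<bar>sin (Re z)\<bar>"
      by linarith
    have "Re (sin z) = sin (Re z) * cosh (Im z)"
      by (simp add: Re_sin cosh_def)
    then have "\<bar>Re (sin z)\<bar> = \<bar>sin (Re z)\<bar> * cosh (Im z)"
      by (simp add: abs_mult)
    moreover have "\<bar>sin (Re z)\<bar> * 1 \<le> \<bar>sin (Re z)\<bar> * cosh (Im z)"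
      using cosh_real_ge_1[of "Im z"] by (intro mult_left_mono) auto
    ultimately have "\<bar>sin (Re z)\<bar> \<le> \<bar>Re (sin z)\<bar>"
      by simp
    then have "cos 1 \<le> norm (sin z)"
      using s abs_Re_le_cmod[of "sin z"] by linarith
    moreover have "c * exp \<bar>Im z\<bar> \<le> cos 1 * exp (- 1) * exp 1"
      using True c c1 by (intro mult_mono) (auto simp: c_def)
    ultimately show ?thesis
      by (simp add: mult.assoc flip: exp_add)
  qed
  ultimately show ?thesis
    using that by blast
qed

section \<open>The characteristic function and the Weyl solution\<close>

text \<open>Reflection makes the boundary condition at \<open>T\<close> an initial condition at 0,
  so results on \<open>sl_u\<close> carry over to solutions normalised at \<open>T\<close>. Only the
  first derivative changes sign.\<close>

lemma sl_sol_reflect: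
  assumes "sl_sol T (\<lambda>s. p (T - s)) lam u v"
  shows "sl_sol T p lam (\<lambda>t. u (T - t)) (\<lambda>t. - v (T - t))"
  unfolding sl_sol_def
proof (intro ballI conjI)
  fix t assume t: "t \<in> {0..T}"
  have im: "(\<lambda>t. T - t) ` {0..T} = {0..T}"
    by (simp add: image_diff_atLeastAtMost)
  have d: "((\<lambda>t. T - t) has_vector_derivative -1) (at t within {0..T})"
    by (auto intro!: derivative_eq_intros)
  have "(u has_vector_derivative v (T - t)) (at (T - t) within (\<lambda>t. T - t) ` {0..T})"
    and dv: "(v has_vector_derivative (of_real (p t) - lam) * u (T - t)) (at (T - t) within (\<lambda>t. T - t) ` {0..T})"
    using bspec[OF assms[unfolded sl_sol_def], of "T - t"] t unfolding im by auto
  from vector_diff_chain_within[OF d this(1)]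
  show "((\<lambda>t. u (T - t)) has_vector_derivative - v (T - t)) (at t within {0..T})"
    by (simp add: o_def)
  from has_vector_derivative_minus[OF vector_diff_chain_within[OF d dv]]
  show "((\<lambda>t. - v (T - t)) has_vector_derivative (of_real (p t) - lam) * u (T - t)) (at t within {0..T})"
    by (simp add: o_def)
qed

text \<open>The Wronskian has derivative \<open>(mu - lam) * (u * u')\<close>. It is constant for
  equal parameters, and for different ones it produces the inner products behind the norming
  constants.\<close>

lemma sl_lagrange_identity:
  assumes s: "sl_sol T p lam u v" and s': "sl_sol T p mu u' v'" and t: "t \<in> {0..T}"
  shows "(v t * u' t - u t * v' t) - (v 0 * u' 0 - u 0 * v' 0) = (mu - lam) * integral {0..t} (\<lambda>s. u s * u' s)"
proof -
  have "((\<lambda>s. v s * u' s - u s * v' s) has_vector_derivative (mu - lam) * (u x * u' x)) (at x within {0..T})"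
    if x: "x \<in> {0..T}" for x
  proof -
    have d: "(u has_vector_derivative v x) (at x within {0..T})"
      "(v has_vector_derivative (of_real (p x) - lam) * u x) (at x within {0..T})"
      "(u' has_vector_derivative v' x) (at x within {0..T})"
      "(v' has_vector_derivative (of_real (p x) - mu) * u' x) (at x within {0..T})"
      using s s' x unfolding sl_sol_def by blast+
    show ?thesis
      by (rule derivative_eq_intros d refl)+ (simp add: algebra_simps)
  qed
  from FTC_within[OF this t] show ?thesis
    by simp
qed

text \<open>The solution with \<open>\<psi>(T) = 1\<close>, \<open>\<psi>'(T) = -H\<close>, obtained by reflecting the interval, and its derivative.\<close>

definition sl_psi :: "real \<Rightarrow> (real \<Rightarrow> real) \<Rightarrow> complex \<Rightarrow> complex \<Rightarrow> real \<Rightarrow> complex" where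
  "sl_psi T p H lam t = sl_u (\<lambda>s. p (T - s)) H lam (T - t)"

definition sl_dpsi :: "real \<Rightarrow> (real \<Rightarrow> real) \<Rightarrow> complex \<Rightarrow> complex \<Rightarrow> real \<Rightarrow> complex" where
  "sl_dpsi T p H lam t = - sl_v (\<lambda>s. p (T - s)) H lam (T - t)"

text \<open>This is \<Delta>; \<open>conf_eigenvalue_iff\<close> identifies its zeros with the
  eigenvalues.\<close>

definition sl_char :: "real \<Rightarrow> (real \<Rightarrow> real) \<Rightarrow> complex \<Rightarrow> complex \<Rightarrow> complex \<Rightarrow> complex" where
  "sl_char T p h H lam = sl_v p h lam T + H * sl_u p h lam T"

lemma continuous_on_reflect:
  fixes p :: "real \<Rightarrow> real"
  assumes "continuous_on {0..T} p"
  shows "continuous_on {0..T} (\<lambda>s. p (T - s))"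
  by (rule continuous_on_compose2[OF assms]) (auto intro!: continuous_intros)

context
  fixes T :: real and p :: "real \<Rightarrow> real" and h H :: complex
  assumes T: "0 < T" and p: "continuous_on {0..T} p"
begin

lemma sl_psi_sol: "sl_sol T p lam (sl_psi T p H lam) (sl_dpsi T p H lam)"
  using sl_sol_reflect[OF sl_uv_sol[OF continuous_on_reflect[OF p]], of lam H]
  unfolding sl_psi_def sl_dpsi_def .

lemma sl_psi_T: "sl_psi T p H lam T = 1" "sl_dpsi T p H lam T = - H"
  using sl_uv_0[OF continuous_on_reflect[OF p]] T by (auto simp: sl_psi_def sl_dpsi_def)

lemma sl_psi_holomorphic: "t \<in> {0..T} \<Longrightarrow> (\<lambda>lam. sl_psi T p H lam t) holomorphic_on UNIV"
  unfolding sl_psi_def by (rule sl_uv_holomorphic[OF continuous_on_reflect[OF p]]) auto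

lemma sl_char_holomorphic: "sl_char T p h H holomorphic_on UNIV"
proof -
  have "T \<in> {0..T}"
    using T by auto
  then have "(\<lambda>lam. sl_v p h lam T + H * sl_u p h lam T) holomorphic_on UNIV"
    by (intro holomorphic_intros sl_uv_holomorphic[OF p])
  then show ?thesis
    by (simp add: sl_char_def[abs_def])
qed

text \<open>The Wronskian of \<phi> and \<psi> does not depend on \<open>t\<close>, and its value at
  \<open>T\<close> is \<Delta>.\<close>

lemma sl_char_wronskian:
  assumes t: "t \<in> {0..T}"
  shows "sl_v p h lam t * sl_psi T p H lam t - sl_u p h lam t * sl_dpsi T p H lam t = sl_char T p h H lam"
  using sl_lagrange_identity[OF sl_uv_sol[OF p, of lam h] sl_psi_sol[of lam] t]
    sl_lagrange_identity[OF sl_uv_sol[OF p, of lam h] sl_psi_sol[of lam], of T] T sl_psi_T[of lam]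
  by (auto simp: sl_char_def mult.commute)

text \<open>At a zero of \<Delta> the Wronskian vanishes at 0, so \<psi> satisfies the left boundary
  condition and is a multiple of \<phi>. Lagrange's identity between \<phi> at \<open>lam\<close>
  and \<psi> at \<open>z\<close> then splits off \<open>z - lam\<close> explicitly, which replaces a
  computation of the derivative of \<Delta>.\<close>

lemma sl_char_factor:
  assumes z: "sl_char T p h H z = 0"
  defines "b \<equiv> sl_psi T p H z 0"
  shows "b \<noteq> 0" "\<And>t. t \<in> {0..T} \<Longrightarrow> sl_psi T p H z t = b * sl_u p h z t"
    "\<And>lam. sl_char T p h H lam = (z - lam) * (b * integral {0..T} (\<lambda>s. sl_u p h lam s * sl_u p h z s))"
proof -
  note uv0 = sl_uv_0[OF p less_imp_le[OF T]]
  have bc: "h * sl_psi T p H z 0 - sl_dpsi T p H z 0 = 0"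
    using sl_char_wronskian[of 0 z] T z uv0 by simp
  have psi0: "sl_psi T p H z 0 = b * sl_u p h z 0" "sl_dpsi T p H z 0 = b * sl_v p h z 0"
    using bc unfolding uv0 b_def by (simp_all add: mult.commute)
  show eq: "sl_psi T p H z t = b * sl_u p h z t" if "t \<in> {0..T}" for t
    by (rule sl_sol_unique(1)[OF p sl_psi_sol sl_uv_sol[OF p] psi0 that])
  then show "b \<noteq> 0"
    using eq[of T] T sl_psi_T(1)[of z] by auto
  fix lam
  have "sl_char T p h H lam - (h * sl_psi T p H z 0 - sl_dpsi T p H z 0)
      = (z - lam) * integral {0..T} (\<lambda>s. sl_u p h lam s * sl_psi T p H z s)"
    using sl_lagrange_identity[OF sl_uv_sol[OF p, of lam h] sl_psi_sol[of z], of T] T sl_psi_T[of z] uv0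
    by (simp add: sl_char_def mult.commute)
  also have "integral {0..T} (\<lambda>s. sl_u p h lam s * sl_psi T p H z s)
      = integral {0..T} (\<lambda>s. b * (sl_u p h lam s * sl_u p h z s))"
    by (intro integral_cong) (simp add: eq)
  finally show "sl_char T p h H lam = (z - lam) * (b * integral {0..T} (\<lambda>s. sl_u p h lam s * sl_u p h z s))"
    using bc by simp
qed

lemma sl_inner_tendsto:
  "((\<lambda>lam. integral {0..T} (\<lambda>s. sl_u p h lam s * sl_u p h z s)) \<longlongrightarrow>
    integral {0..T} (\<lambda>s. (sl_u p h z s)\<^sup>2)) (at z)"
proof -
  let ?U = "cball 0 (norm z + 1)"
  have z: "z \<in> interior ?U"
    by simp
  have "continuous_on (?U \<times> {0..T}) (\<lambda>x. sl_u p h z (snd x))"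
    by (rule continuous_on_compose2[OF sl_uv_continuous(1)[OF p]]) (auto intro!: continuous_intros)
  then have "continuous_on (?U \<times> cbox 0 T) (\<lambda>(lam, s). sl_u p h lam s * sl_u p h z s)"
    using sl_u_joint_continuous[OF p, of "norm z + 1" h]
    unfolding case_prod_unfold by (auto intro!: continuous_intros)
  then have "continuous_on ?U (\<lambda>lam. integral (cbox 0 T) (\<lambda>s. sl_u p h lam s * sl_u p h z s))"
    by (rule integral_continuous_on_param)
  then have "isCont (\<lambda>lam. integral {0..T} (\<lambda>s. sl_u p h lam s * sl_u p h z s)) z"
    using continuous_on_interior[OF _ z] by simp
  then show ?thesis
    by (simp add: isCont_def power2_eq_square)
qed

text \<open>The factor \<open>lam - z\<close> cancels against the factorisation of \<Delta>, and
  \<open>b\<close> cancels because \<psi> is \<open>b\<close> times \<phi> at \<open>z\<close>. The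
  nonzero norming integral makes the zero simple and isolated.\<close>

lemma sl_weyl_residue:
  assumes z: "sl_char T p h H z = 0" and nz: "integral {0..T} (\<lambda>s. (sl_u p h z s)\<^sup>2) \<noteq> 0"
  shows "eventually (\<lambda>lam. sl_char T p h H lam \<noteq> 0) (at z)"
    and "t \<in> {0..T} \<Longrightarrow> ((\<lambda>lam. (lam - z) * (sl_psi T p H lam t / sl_char T p h H lam)) \<longlongrightarrow>
      - sl_u p h z t / integral {0..T} (\<lambda>s. (sl_u p h z s)\<^sup>2)) (at z)"
proof -
  define b where "b = sl_psi T p H z 0"
  note f = sl_char_factor[OF z, folded b_def]
  let ?I = "\<lambda>lam. integral {0..T} (\<lambda>s. sl_u p h lam s * sl_u p h z s)"
  let ?a = "integral {0..T} (\<lambda>s. (sl_u p h z s)\<^sup>2)"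
  have ev: "eventually (\<lambda>lam. lam \<noteq> z \<and> ?I lam \<noteq> 0) (at z)"
    by (intro eventually_conj tendsto_imp_eventually_ne[OF sl_inner_tendsto nz])
       (simp add: eventually_at_filter)
  then show "eventually (\<lambda>lam. sl_char T p h H lam \<noteq> 0) (at z)"
    by eventually_elim (use f in auto)
  assume t: "t \<in> {0..T}"
  have "isCont (\<lambda>lam. sl_psi T p H lam t) z"
    using sl_psi_holomorphic[OF t] holomorphic_on_imp_continuous_on
    by (metis UNIV_I continuous_on_eq_continuous_at open_UNIV)
  then have "((\<lambda>lam. - (sl_psi T p H lam t) / (b * ?I lam)) \<longlongrightarrow> - (sl_psi T p H z t) / (b * ?a)) (at z)"
    using f(1) nz by (intro tendsto_intros sl_inner_tendsto) (auto simp: isCont_def)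
  also have "- (sl_psi T p H z t) / (b * ?a) = - sl_u p h z t / ?a"
    using f(1) f(2)[OF t] by simp
  finally show "((\<lambda>lam. (lam - z) * (sl_psi T p H lam t / sl_char T p h H lam)) \<longlongrightarrow>
      - sl_u p h z t / ?a) (at z)"
  proof (rule Lim_transform_eventually)
    show "\<forall>\<^sub>F lam in at z. - sl_psi T p H lam t / (b * ?I lam)
        = (lam - z) * (sl_psi T p H lam t / sl_char T p h H lam)"
      using ev
    proof eventually_elim
      case (elim lam)
      define d where "d = z - lam"
      have "lam - z = - d" "d \<noteq> 0"
        using elim by (auto simp: d_def)
      then show ?case
        unfolding f(3)[of lam] d_def[symmetric] using f(1) elim by simp
    qed
  qed
qed

end

section \<open>Growth estimates on the circles\<close>

lemma sl_u_bound:
  assumes p: "continuous_on {0..T} p" and T: "0 < T"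
  obtains C where "0 < C" "\<And>r t. 1 \<le> norm r \<Longrightarrow> t \<in> {0..T} \<Longrightarrow>
      norm (sl_u p h (r\<^sup>2) t) \<le> C * exp (\<bar>Im r\<bar> * t)"
proof -
  obtain K where K: "0 < K" "\<And>r t. 1 \<le> norm r \<Longrightarrow> t \<in> {0..T} \<Longrightarrow>
      norm (sl_u p h (r\<^sup>2) t - cos (r * t)) \<le> K * exp (\<bar>Im r\<bar> * t) / norm r"
    using sl_uv_asymptotics[OF p T] by metis
  have "norm (sl_u p h (r\<^sup>2) t) \<le> (K + 1) * exp (\<bar>Im r\<bar> * t)"
    if r: "1 \<le> norm r" and t: "t \<in> {0..T}" for r t
  proof -
    have "norm (cos (r * t)) \<le> exp (\<bar>Im r\<bar> * t)"
      using norm_cos_le_exp[of "r * t"] t by (simp add: abs_mult)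
    moreover have "K * exp (\<bar>Im r\<bar> * t) / norm r \<le> K * exp (\<bar>Im r\<bar> * t) / 1"
      using K(1) r by (intro divide_left_mono) auto
    moreover have "norm (sl_u p h (r\<^sup>2) t) \<le> norm (sl_u p h (r\<^sup>2) t - cos (r * t)) + norm (cos (r * t))"
      using norm_triangle_ineq[of "sl_u p h (r\<^sup>2) t - cos (r * t)" "cos (r * t)"] by simp
    ultimately show ?thesis
      using K(2)[OF r t] by (simp add: distrib_right)
  qed
  with K(1) that[of "K + 1"] show ?thesis
    by simp
qed

text \<open>On these circles the leading term \<open>- r * sin (r * T)\<close> has size
  \<open>norm r * exp (\<bar>Im r\<bar> * T)\<close>, and the other terms lack the factor
  \<open>norm r\<close>.\<close>

lemma sl_char_lower_bound:
  assumes p: "continuous_on {0..T} p" and T: "0 < T"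
  obtains c N where "0 < c" "\<And>(n::nat) r. N \<le> n \<Longrightarrow> norm r = (of_nat n + 1 / 2) * pi / T \<Longrightarrow>
      c * norm r * exp (\<bar>Im r\<bar> * T) \<le> norm (sl_char T p h H (r\<^sup>2)) \<and> 1 \<le> norm r"
proof -
  obtain K where K: "0 < K"
    "\<And>r t. 1 \<le> norm r \<Longrightarrow> t \<in> {0..T} \<Longrightarrow>
      norm (sl_v p h (r\<^sup>2) t + r * sin (r * t)) \<le> K * exp (\<bar>Im r\<bar> * t)"
    using sl_uv_asymptotics[OF p T] by metis
  obtain C where C: "0 < C" "\<And>r t. 1 \<le> norm r \<Longrightarrow> t \<in> {0..T} \<Longrightarrow>
      norm (sl_u p h (r\<^sup>2) t) \<le> C * exp (\<bar>Im r\<bar> * t)"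
    using sl_u_bound[OF p T] by metis
  obtain c where c: "0 < c"
    "\<And>(n::nat) z::complex. 1 \<le> n \<Longrightarrow> norm z = (of_nat n + 1 / 2) * pi \<Longrightarrow> c * exp \<bar>Im z\<bar> \<le> norm (sin z)"
    using norm_sin_lower_bound by metis
  \<comment> \<open>\<open>L\<close> collects the error terms. \<open>N\<close> makes
    \<open>norm r\<close> large enough that \<open>L\<close> takes up at most half of the leading
    term; the 1 in the maximum secures \<open>1 \<le> norm r\<close>, as the asymptotics
    require.\<close>
  define L where "L = K + norm H * C"
  obtain N :: nat where N: "max 1 (2 * L / c) * T \<le> of_nat N"
    using real_arch_simple by blast
  have "c / 2 * norm r * exp (\<bar>Im r\<bar> * T) \<le> norm (sl_char T p h H (r\<^sup>2)) \<and> 1 \<le> norm r"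
    if n: "max N 1 \<le> n" and r: "norm r = (of_nat n + 1 / 2) * pi / T" for n :: nat and r
  proof -
    have "max 1 (2 * L / c) * T \<le> of_nat n * 1"
      using n N by (simp add: max_def split: if_splits)
    also have "\<dots> \<le> (of_nat n + 1 / 2) * pi"
      using pi_gt3 by (intro mult_mono) auto
    finally have "max 1 (2 * L / c) \<le> norm r"
      unfolding r using T by (simp add: le_divide_eq)
    then have r1: "1 \<le> norm r" and rL: "L \<le> c / 2 * norm r"
      using c(1) by (auto simp: field_simps)
    let ?e = "exp (\<bar>Im r\<bar> * T)"
    have TT: "T \<in> {0..T}"
      using T by auto
    have "norm (r * T) = (of_nat n + 1 / 2) * pi"
      using T r by (simp add: norm_mult)
    then have "c * ?e \<le> norm (sin (r * T))"
      using c(2)[of n "r * T"] n T by (simp add: abs_mult)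
    then have "norm r * (c * ?e) \<le> norm (r * sin (r * T))"
      unfolding norm_mult by (intro mult_left_mono) auto
    moreover have "norm (sl_v p h (r\<^sup>2) T + r * sin (r * T)) \<le> K * ?e"
      by (rule K(2)[OF r1 TT])
    moreover have "norm (H * sl_u p h (r\<^sup>2) T) \<le> norm H * (C * ?e)"
      unfolding norm_mult by (intro mult_left_mono C(2)[OF r1 TT]) auto
    moreover have "norm (r * sin (r * T)) \<le> norm (sl_char T p h H (r\<^sup>2)) +
        norm (sl_v p h (r\<^sup>2) T + r * sin (r * T)) + norm (H * sl_u p h (r\<^sup>2) T)"
    proof -
      have "r * sin (r * T) = (sl_v p h (r\<^sup>2) T + r * sin (r * T)) + H * sl_u p h (r\<^sup>2) T - sl_char T p h H (r\<^sup>2)"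
        by (simp add: sl_char_def)
      then have "norm (r * sin (r * T)) \<le> norm ((sl_v p h (r\<^sup>2) T + r * sin (r * T)) + H * sl_u p h (r\<^sup>2) T)
          + norm (sl_char T p h H (r\<^sup>2))"
        by (metis norm_triangle_ineq4)
      then show ?thesis
        using norm_triangle_ineq[of "sl_v p h (r\<^sup>2) T + r * sin (r * T)" "H * sl_u p h (r\<^sup>2) T"] by linarith
    qed
    ultimately have "norm r * (c * ?e) \<le> norm (sl_char T p h H (r\<^sup>2)) + K * ?e + norm H * (C * ?e)"
      by linarith
    then have "norm r * (c * ?e) \<le> norm (sl_char T p h H (r\<^sup>2)) + L * ?e"
      by (simp add: L_def algebra_simps)
    moreover have "L * ?e \<le> c / 2 * norm r * ?e"
      using rL by (intro mult_right_mono) auto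
    moreover have "norm r * (c * ?e) = 2 * (c / 2 * norm r * ?e)"
      by simp
    ultimately show ?thesis
      using r1 by linarith
  qed
  then show ?thesis
    using that[of "c / 2" "max N 1"] c(1) by simp
qed

text \<open>The exponential rates \<open>T - t\<close> of \<psi> and \<open>t\<close> of the
  solution from the left add up to the rate \<open>T\<close> of \<Delta>, so only
  \<open>1 / norm r\<close> survives. The two factors may belong to different potentials.\<close>

lemma sl_weyl_bound:
  assumes p: "continuous_on {0..T} p" and p': "continuous_on {0..T} p'" and T: "0 < T"
  obtains C N where "0 < C" "\<And>(n::nat) r t. N \<le> n \<Longrightarrow> norm r = (of_nat n + 1 / 2) * pi / T \<Longrightarrow> t \<in> {0..T} \<Longrightarrow>
      sl_char T p h H (r\<^sup>2) \<noteq> 0 \<and>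
      norm (sl_psi T p H (r\<^sup>2) t / sl_char T p h H (r\<^sup>2) * sl_u p' h' (r\<^sup>2) t) \<le> C / norm r"
proof -
  obtain c N where c: "0 < c" "\<And>(n::nat) r. N \<le> n \<Longrightarrow> norm r = (of_nat n + 1 / 2) * pi / T \<Longrightarrow>
      c * norm r * exp (\<bar>Im r\<bar> * T) \<le> norm (sl_char T p h H (r\<^sup>2)) \<and> 1 \<le> norm r"
    using sl_char_lower_bound[OF p T] by metis
  obtain C1 where C1: "0 < C1" "\<And>r t. 1 \<le> norm r \<Longrightarrow> t \<in> {0..T} \<Longrightarrow>
      norm (sl_u (\<lambda>s. p (T - s)) H (r\<^sup>2) t) \<le> C1 * exp (\<bar>Im r\<bar> * t)"
    using sl_u_bound[OF continuous_on_reflect[OF p] T] by metis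
  obtain C2 where C2: "0 < C2" "\<And>r t. 1 \<le> norm r \<Longrightarrow> t \<in> {0..T} \<Longrightarrow>
      norm (sl_u p' h' (r\<^sup>2) t) \<le> C2 * exp (\<bar>Im r\<bar> * t)"
    using sl_u_bound[OF p' T] by metis
  have "sl_char T p h H (r\<^sup>2) \<noteq> 0 \<and>
      norm (sl_psi T p H (r\<^sup>2) t / sl_char T p h H (r\<^sup>2) * sl_u p' h' (r\<^sup>2) t) \<le> (C1 * C2 / c) / norm r"
    if n: "N \<le> n" and r: "norm r = (of_nat n + 1 / 2) * pi / T" and t: "t \<in> {0..T}" for n :: nat and r t
  proof -
    let ?e = "exp (\<bar>Im r\<bar> * T)" and ?D = "sl_char T p h H (r\<^sup>2)"
    have r1: "1 \<le> norm r" and D: "c * norm r * ?e \<le> norm ?D"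
      using c(2)[OF n r] by auto
    have pos: "0 < c * norm r * ?e"
      using c(1) r1 by (intro mult_pos_pos) (auto intro: less_le_trans[OF zero_less_one])
    have "norm (sl_psi T p H (r\<^sup>2) t) \<le> C1 * exp (\<bar>Im r\<bar> * (T - t))"
      unfolding sl_psi_def using t by (intro C1(2) r1) auto
    then have "norm (sl_psi T p H (r\<^sup>2) t) * norm (sl_u p' h' (r\<^sup>2) t)
        \<le> (C1 * exp (\<bar>Im r\<bar> * (T - t))) * (C2 * exp (\<bar>Im r\<bar> * t))"
      using C1(1) C2(1) by (intro mult_mono C2(2)[OF r1 t]) auto
    also have "\<dots> = C1 * C2 * ?e"
      by (simp add: right_diff_distrib exp_diff)
    finally have "norm (sl_psi T p H (r\<^sup>2) t) * norm (sl_u p' h' (r\<^sup>2) t) / norm ?D \<le> (C1 * C2 * ?e) / (c * norm r * ?e)"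
      using D pos C1(1) C2(1) by (intro frac_le) auto
    then show ?thesis
      using D pos by (auto simp: norm_mult norm_divide)
  qed
  then show ?thesis
    using that[of "C1 * C2 / c" N] c(1) C1(1) C2(1) by simp
qed

section \<open>Uniqueness for the Sturm--Liouville problem\<close>

text \<open>The singularities are removable, since \<open>(w - z) * f w\<close> tends to 0, and the
  entire extension is bounded at \<open>w\<close> by \<open>\<epsilon> n\<close> for all large
  \<open>n\<close> by the maximum modulus principle.\<close>

lemma vanishing_on_circles_imp_zero:
  fixes f :: "complex \<Rightarrow> complex" and R \<epsilon> :: "nat \<Rightarrow> real"
  assumes A: "open A" "f holomorphic_on A"
    and sing: "\<And>z. z \<notin> A \<Longrightarrow> eventually (\<lambda>w. w \<in> A) (at z)"
      "\<And>z. z \<notin> A \<Longrightarrow> ((\<lambda>w. (w - z) * f w) \<longlongrightarrow> 0) (at z)"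
    and R: "filterlim R at_top sequentially" and \<epsilon>: "\<epsilon> \<longlonglongrightarrow> 0"
    and circ: "eventually (\<lambda>n. \<forall>w. norm w = R n \<longrightarrow> w \<in> A \<and> norm (f w) \<le> \<epsilon> n) sequentially"
    and w: "w \<in> A"
  shows "f w = 0"
proof -
  \<comment> \<open>Off \<open>A\<close> the values of \<open>f\<close> are arbitrary, for instance
    quotients by zero; \<open>remove_sings\<close> puts the limits in their place.\<close>
  define g where "g = remove_sings f"
  have fA: "f analytic_on {z}" if "z \<in> A" for z
    using A that by (auto simp: analytic_at)
  have gf: "g z = f z" if "z \<in> A" for z
    using fA[OF that] by (simp add: g_def)
  have "g analytic_on {z}" for z
  proof (cases "z \<in> A")
    case True
    then show ?thesis
      unfolding g_def by (intro remove_sings_analytic_on fA)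
  next
    case False
    then obtain d where d: "0 < d" "\<And>w. w \<noteq> z \<Longrightarrow> dist w z < d \<Longrightarrow> w \<in> A"
      using sing(1)[OF False] by (auto simp: eventually_at)
    have hol: "f holomorphic_on ball z d - {z}"
    proof (rule holomorphic_on_subset[OF A(2)])
      show "ball z d - {z} \<subseteq> A"
      proof
        fix x assume "x \<in> ball z d - {z}"
        then show "x \<in> A"
          using d(2)[of x] by (auto simp: dist_commute)
      qed
    qed
    have zi: "z \<in> interior (ball z d)"
      using d by simp
    obtain k where k: "k holomorphic_on ball z d" "\<And>w. w \<in> ball z d - {z} \<Longrightarrow> k w = f w"
      using sing(2)[OF False] holomorphic_on_extend_lim[OF hol zi] by blast
    have "isCont k z"
      using k(1) d(1) holomorphic_on_imp_continuous_on continuous_on_eq_continuous_at open_ball centre_in_ball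
      by metis
    then have "(k \<longlongrightarrow> k z) (at z)"
      by (simp add: isCont_def)
    moreover have "eventually (\<lambda>w. k w = f w) (at z)"
      unfolding eventually_at using d(1) k(2) by (intro exI[of _ d]) (auto simp: dist_commute)
    ultimately have "(f \<longlongrightarrow> k z) (at z)"
      by (rule Lim_transform_eventually)
    then show ?thesis
      unfolding g_def
      using d(1) by (intro remove_sings_analytic_at isolated_singularity_at_holomorphic[OF hol]) auto
  qed
  then have g: "g holomorphic_on UNIV"
    using analytic_imp_holomorphic analytic_on_analytic_at by blast
  have "eventually (\<lambda>n. norm (g w) \<le> \<epsilon> n) sequentially"
    using circ filterlim_at_top_dense[THEN iffD1, OF R, rule_format, of "norm w"]
  proof eventually_elim
    case (elim n)
    have "0 < R n"
      using elim norm_ge_zero[of w] by linarith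
    show ?case
    proof (rule maximum_modulus_frontier[where f = g and \<xi> = w and S = "ball 0 (R n)"])
      show "w \<in> ball 0 (R n)"
        using elim by simp
      fix z :: complex assume "z \<in> frontier (ball 0 (R n))"
      then have "norm z = R n"
        using \<open>0 < R n\<close> by simp
      then show "norm (g z) \<le> \<epsilon> n"
        using elim gf[of z] by auto
    qed (use g in \<open>auto intro: holomorphic_on_subset holomorphic_on_imp_continuous_on[THEN continuous_on_subset]\<close>)
  qed
  then have "norm (g w) \<le> 0"
    using \<epsilon> by (intro tendsto_lowerbound[OF \<epsilon>]) auto
  then show ?thesis
    using gf[OF w] by simp
qed

lemma sl_weyl_cross_zero:
  assumes T: "0 < T" and p: "continuous_on {0..T} p" and pt: "continuous_on {0..T} pt"
    and same: "\<And>z. sl_char T p h H z = 0 \<longleftrightarrow> sl_char T pt ht Ht z = 0"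
    and nz: "\<And>z. sl_char T p h H z = 0 \<Longrightarrow> integral {0..T} (\<lambda>s. (sl_u p h z s)\<^sup>2) \<noteq> 0"
    and nc: "\<And>z. sl_char T p h H z = 0 \<Longrightarrow>
      integral {0..T} (\<lambda>s. (sl_u p h z s)\<^sup>2) = integral {0..T} (\<lambda>s. (sl_u pt ht z s)\<^sup>2)"
    and t: "t \<in> {0..T}" and lam: "sl_char T p h H lam \<noteq> 0"
  shows "sl_psi T p H lam t / sl_char T p h H lam * sl_u pt ht lam t =
    sl_psi T pt Ht lam t / sl_char T pt ht Ht lam * sl_u p h lam t"
proof -
  define A where "A = {z. sl_char T p h H z \<noteq> 0}"
  define f where "f = (\<lambda>lam. sl_psi T p H lam t / sl_char T p h H lam * sl_u pt ht lam t -
    sl_psi T pt Ht lam t / sl_char T pt ht Ht lam * sl_u p h lam t)"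
  obtain C N where C: "0 < C" "\<And>(n::nat) r. N \<le> n \<Longrightarrow> norm r = (of_nat n + 1 / 2) * pi / T \<Longrightarrow>
      sl_char T p h H (r\<^sup>2) \<noteq> 0 \<and>
      norm (sl_psi T p H (r\<^sup>2) t / sl_char T p h H (r\<^sup>2) * sl_u pt ht (r\<^sup>2) t) \<le> C / norm r"
    using sl_weyl_bound[OF p pt T] t by metis
  obtain C' N' where C': "0 < C'" "\<And>(n::nat) r. N' \<le> n \<Longrightarrow> norm r = (of_nat n + 1 / 2) * pi / T \<Longrightarrow>
      sl_char T pt ht Ht (r\<^sup>2) \<noteq> 0 \<and>
      norm (sl_psi T pt Ht (r\<^sup>2) t / sl_char T pt ht Ht (r\<^sup>2) * sl_u p h (r\<^sup>2) t) \<le> C' / norm r"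
    using sl_weyl_bound[OF pt p T] t by metis
  define \<rho> where "\<rho> = (\<lambda>n::nat. (of_nat n + 1 / 2) * pi / T)"
  have \<rho>: "filterlim \<rho> at_top sequentially"
  proof -
    have "filterlim (\<lambda>n. (pi / T) * (1 / 2 + of_nat n)) at_top sequentially"
      using T by (intro filterlim_tendsto_pos_mult_at_top[OF tendsto_const]
          filterlim_tendsto_add_at_top[OF tendsto_const] filterlim_real_sequentially) auto
    moreover have "(\<lambda>n. (pi / T) * (1 / 2 + of_nat n)) = \<rho>"
      by (auto simp: \<rho>_def field_simps)
    ultimately show ?thesis
      by simp
  qed
  have \<rho>0: "0 < \<rho> n" for n
    using T by (simp add: \<rho>_def add_nonneg_pos)
  have "f lam = 0"
  proof (rule vanishing_on_circles_imp_zero[where f = f and w = lam and A = A and R = "\<lambda>n. (\<rho> n)\<^sup>2" and \<epsilon> = "\<lambda>n. (C + C') / \<rho> n"])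
    have "continuous_on UNIV (sl_char T p h H)"
      by (intro holomorphic_on_imp_continuous_on sl_char_holomorphic T p)
    then show "open A"
      unfolding A_def by (intro open_Collect_neq continuous_intros)
    have sub: "k holomorphic_on UNIV \<Longrightarrow> k holomorphic_on A" for k :: "complex \<Rightarrow> complex"
      by (rule holomorphic_on_subset) auto
    show "f holomorphic_on A"
      unfolding f_def using same
      by (intro holomorphic_intros sub sl_psi_holomorphic sl_char_holomorphic sl_uv_holomorphic[where T = T] T p pt t)
         (auto simp: A_def)
    show "filterlim (\<lambda>n. (\<rho> n)\<^sup>2) at_top sequentially"
      by (intro filterlim_pow_at_top \<rho>) auto
    show "(\<lambda>n. (C + C') / \<rho> n) \<longlonglongrightarrow> 0"
      by (rule real_tendsto_divide_at_top[OF tendsto_const \<rho>])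
    show "\<forall>\<^sub>F n in sequentially. \<forall>w. norm w = (\<rho> n)\<^sup>2 \<longrightarrow> w \<in> A \<and> norm (f w) \<le> (C + C') / \<rho> n"
      using eventually_ge_at_top[of "max N N'"]
    proof eventually_elim
      case (elim n)
      show ?case
      proof (intro allI impI)
        fix w :: complex assume w: "norm w = (\<rho> n)\<^sup>2"
        \<comment> \<open>The bounds are stated in \<open>r\<close> with
          \<open>w = r\<^sup>2\<close>; the root maps the circle of radius
          \<open>(\<rho> n)\<^sup>2\<close> into the one of radius \<open>\<rho> n\<close>.\<close>
        define r where "r = csqrt w"
        have r: "w = r\<^sup>2" "norm r = \<rho> n"
          using w \<rho>0[of n] by (auto simp: r_def)
        note b = C(2)[of n r] C'(2)[of n r]
        show "w \<in> A \<and> norm (f w) \<le> (C + C') / \<rho> n"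
        proof
          show "w \<in> A"
            using b elim r by (simp add: A_def \<rho>_def)
          have "norm (f w) \<le> C / norm r + C' / norm r"
            unfolding f_def r(1) using b elim r
            by (intro order_trans[OF norm_triangle_ineq4] add_mono) (auto simp: \<rho>_def)
          then show "norm (f w) \<le> (C + C') / \<rho> n"
            by (simp add: r add_divide_distrib)
        qed
      qed
    qed
    fix z assume "z \<notin> A"
    then have z: "sl_char T p h H z = 0" "sl_char T pt ht Ht z = 0"
      using same by (auto simp: A_def)
    note n = nz[OF z(1)] and nt = nz[OF z(1), unfolded nc[OF z(1)]]
    show "\<forall>\<^sub>F w in at z. w \<in> A"
      using sl_weyl_residue(1)[OF T p z(1) n] by (simp add: A_def)
    have cont: "((\<lambda>lam. sl_u q k lam t) \<longlongrightarrow> sl_u q k z t) (at z)" if "continuous_on {0..T} q" for q k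
      using sl_uv_holomorphic(1)[OF that t, of k, THEN holomorphic_on_imp_continuous_on]
      by (simp add: continuous_on_eq_continuous_at isCont_def)
    \<comment> \<open>Both residues are minus the product of the two left solutions over the common
      norming integral, so their difference is 0.\<close>
    have "((\<lambda>lam. (lam - z) * (sl_psi T p H lam t / sl_char T p h H lam) * sl_u pt ht lam t -
        (lam - z) * (sl_psi T pt Ht lam t / sl_char T pt ht Ht lam) * sl_u p h lam t) \<longlongrightarrow>
      - sl_u p h z t / integral {0..T} (\<lambda>s. (sl_u p h z s)\<^sup>2) * sl_u pt ht z t -
      - sl_u pt ht z t / integral {0..T} (\<lambda>s. (sl_u pt ht z s)\<^sup>2) * sl_u p h z t) (at z)"
      by (intro tendsto_intros sl_weyl_residue(2) T p pt z n nt t cont)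
    then show "((\<lambda>w. (w - z) * f w) \<longlongrightarrow> 0) (at z)"
      by (simp add: f_def nc[OF z(1)] right_diff_distrib mult_ac)
  qed (use lam in \<open>simp add: A_def\<close>)
  then show ?thesis
    by (simp add: f_def)
qed

text \<open>Agreement of the two left solutions is needed for only one value of \<open>lam\<close>,
  chosen negative and large in modulus.\<close>

theorem sl_uniqueness:
  assumes T: "0 < T" and p: "continuous_on {0..T} p" and pt: "continuous_on {0..T} pt"
    and same: "\<And>z. sl_char T p h H z = 0 \<longleftrightarrow> sl_char T pt ht Ht z = 0"
    and nz: "\<And>z. sl_char T p h H z = 0 \<Longrightarrow> integral {0..T} (\<lambda>s. (sl_u p h z s)\<^sup>2) \<noteq> 0"
    and nc: "\<And>z. sl_char T p h H z = 0 \<Longrightarrow>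
      integral {0..T} (\<lambda>s. (sl_u p h z s)\<^sup>2) = integral {0..T} (\<lambda>s. (sl_u pt ht z s)\<^sup>2)"
  shows "h = ht" and "t \<in> {0..T} \<Longrightarrow> p t = pt t"
proof -
  \<comment> \<open>At the endpoints this is uniqueness of one-sided derivatives on a nondegenerate
    interval.\<close>
  have unique: "x = y" if "(f has_vector_derivative x) (at t within {0..T})"
    "(g has_vector_derivative y) (at t within {0..T})" "\<And>s. s \<in> {0..T} \<Longrightarrow> f s = g s" "t \<in> {0..T}"
    for f g :: "real \<Rightarrow> complex" and x y t
  proof -
    have "(f has_vector_derivative y) (at t within {0..T})"
      using that by (intro has_vector_derivative_transform[OF _ _ that(2)]) auto
    moreover have "at t within {0..T} \<noteq> bot"
      using T that(4) by (auto simp: at_within_Icc_at_right trivial_limit_within islimpt_Icc)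
    ultimately show ?thesis
      using vector_derivative_unique_within that(1) by blast
  qed
  obtain K where K: "0 < K" "\<And>r t. 1 \<le> norm r \<Longrightarrow> t \<in> {0..T} \<Longrightarrow>
      norm (sl_u p h (r\<^sup>2) t - cos (r * t)) \<le> K * exp (\<bar>Im r\<bar> * t) / norm r"
    using sl_uv_asymptotics[OF p T] by metis
  obtain Kt where Kt: "0 < Kt" "\<And>r t. 1 \<le> norm r \<Longrightarrow> t \<in> {0..T} \<Longrightarrow>
      norm (sl_u pt ht (r\<^sup>2) t - cos (r * t)) \<le> Kt * exp (\<bar>Im r\<bar> * t) / norm r"
    using sl_uv_asymptotics[OF pt T] by metis
  obtain c N where c: "0 < c" "\<And>(n::nat) r. N \<le> n \<Longrightarrow> norm r = (of_nat n + 1 / 2) * pi / T \<Longrightarrow>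
      c * norm r * exp (\<bar>Im r\<bar> * T) \<le> norm (sl_char T p h H (r\<^sup>2)) \<and> 1 \<le> norm r"
    using sl_char_lower_bound[OF p T] by metis
  \<comment> \<open>\<open>N'\<close> forces \<open>K / k\<close> and \<open>Kt / k\<close> below
    1/4, while \<open>N\<close> and the half-integer form of \<open>k\<close> ensure that \<Delta>
    does not vanish at \<open>lam\<close>.\<close>
  obtain N' :: nat where N': "(4 * (K + Kt)) * T / pi \<le> of_nat N'"
    using real_arch_simple by blast
  define n where "n = max N N'"
  define k where "k = (of_nat n + 1 / 2) * pi / T"
  have kpos: "0 < k"
    using T by (simp add: k_def add_nonneg_pos)
  \<comment> \<open>For imaginary \<open>r\<close> the parameter is \<open>- k\<^sup>2\<close> and
    \<open>cos (r * t)\<close> becomes \<open>cosh (k * t)\<close>, which stays above half of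
    \<open>exp (k * t)\<close>.\<close>
  define r where "r = \<i> * of_real k"
  define lam where "lam = r\<^sup>2"
  have nr: "norm r = k" and ir: "\<bar>Im r\<bar> = k"
    using kpos by (auto simp: r_def norm_mult)
  have r1: "1 \<le> norm r" and D0: "sl_char T p h H lam \<noteq> 0"
  proof -
    have *: "c * norm r * exp (\<bar>Im r\<bar> * T) \<le> norm (sl_char T p h H (r\<^sup>2)) \<and> 1 \<le> norm r"
      using nr by (intro c(2)[of n]) (auto simp: n_def k_def)
    moreover have "0 < c * norm r * exp (\<bar>Im r\<bar> * T)"
      using c(1) nr kpos by simp
    ultimately show "1 \<le> norm r" "sl_char T p h H lam \<noteq> 0"
      by (auto simp: lam_def)
  qed
  have Dt0: "sl_char T pt ht Ht lam \<noteq> 0"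
    using same D0 by simp
  have kK: "4 * (K + Kt) < k"
  proof -
    have "(4 * (K + Kt)) * T / pi < of_nat n + 1 / 2"
      using N' by (auto simp: n_def)
    then show ?thesis
      using T by (simp add: k_def field_simps)
  qed
  let ?u = "sl_u p h lam" and ?v = "sl_v p h lam" and ?ut = "sl_u pt ht lam" and ?vt = "sl_v pt ht lam"
  define D where "D = sl_char T p h H lam"
  define Dt where "Dt = sl_char T pt ht Ht lam"
  let ?w = "\<lambda>t. sl_psi T p H lam t / D" and ?dw = "\<lambda>t. sl_dpsi T p H lam t / D"
  let ?wt = "\<lambda>t. sl_psi T pt Ht lam t / Dt" and ?dwt = "\<lambda>t. sl_dpsi T pt Ht lam t / Dt"
  have close: "norm (?u t - of_real (cosh (k * t))) < exp (k * t) / 4"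
    "norm (?ut t - of_real (cosh (k * t))) < exp (k * t) / 4" if t: "t \<in> {0..T}" for t
  proof -
    have cos: "cos (r * t) = of_real (cosh (k * t))"
      by (simp add: r_def cos_exp_eq cosh_def mult.assoc exp_of_real flip: of_real_mult of_real_minus)
    have lt: "K / k < 1 / 4" "Kt / k < 1 / 4"
      using kK K(1) Kt(1) kpos by (simp_all add: field_simps)
    have "norm (?u t - cos (r * t)) \<le> K / k * exp (k * t)" "norm (?ut t - cos (r * t)) \<le> Kt / k * exp (k * t)"
      using K(2)[OF r1 t] Kt(2)[OF r1 t] by (simp_all add: lam_def nr ir)
    moreover have "K / k * exp (k * t) < 1 / 4 * exp (k * t)" "Kt / k * exp (k * t) < 1 / 4 * exp (k * t)"
      using lt by (intro mult_strict_right_mono; simp)+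
    ultimately show "norm (?u t - of_real (cosh (k * t))) < exp (k * t) / 4"
      "norm (?ut t - of_real (cosh (k * t))) < exp (k * t) / 4"
      unfolding cos by linarith+
  qed
  have cosh: "exp (k * t) / 2 \<le> cosh (k * t)" for t
    by (simp add: cosh_def)
  have u0: "?u t \<noteq> 0" if t: "t \<in> {0..T}" for t
  proof
    assume "?u t = 0"
    then have "\<bar>cosh (k * t)\<bar> < exp (k * t) / 4"
      using close(1)[OF t] by simp
    then show False
      using cosh[of t] exp_gt_zero[of "k * t"] by linarith
  qed
  have cross: "?w t * ?ut t = ?wt t * ?u t" if "t \<in> {0..T}" for t
    unfolding D_def Dt_def by (rule sl_weyl_cross_zero[OF T p pt same nz nc that D0])
  have wr: "?v t * ?w t - ?u t * ?dw t = 1" "?vt t * ?wt t - ?ut t * ?dwt t = 1" if t: "t \<in> {0..T}" for t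
    using sl_char_wronskian[OF T p t, of h lam H] sl_char_wronskian[OF T pt t, of ht lam Ht] D0 Dt0
    unfolding D_def Dt_def by (simp_all add: field_simps)
  note sol = sl_uv_sol[OF p, of lam h, unfolded sl_sol_def, rule_format]
    and solt = sl_uv_sol[OF pt, of lam ht, unfolded sl_sol_def, rule_format]
    and psol = sl_psi_sol[OF T p, of lam H, unfolded sl_sol_def, rule_format]
    and psolt = sl_psi_sol[OF T pt, of lam Ht, unfolded sl_sol_def, rule_format]
  have sq: "(?u t)\<^sup>2 = (?ut t)\<^sup>2" if t: "t \<in> {0..T}" for t
  proof -
    note d = sol[OF t, THEN conjunct1] solt[OF t, THEN conjunct1]
      psol[OF t, THEN conjunct1] psolt[OF t, THEN conjunct1]
    have d1: "((\<lambda>t. ?w t * ?ut t) has_vector_derivative ?w t * ?vt t + ?dw t * ?ut t) (at t within {0..T})"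
      by (rule derivative_eq_intros d refl)+
    have d2: "((\<lambda>t. ?wt t * ?u t) has_vector_derivative ?wt t * ?v t + ?dwt t * ?u t) (at t within {0..T})"
      by (rule derivative_eq_intros d refl)+
    have eq: "?w t * ?vt t + ?dw t * ?ut t = ?wt t * ?v t + ?dwt t * ?u t"
      by (rule unique[OF d1 d2 cross t])
    show ?thesis
      \<comment> \<open>Multiply \<open>eq\<close> by \<open>?u t * ?ut t\<close> and eliminate
        \<open>?dw\<close> and \<open>?dwt\<close> by the Wronskians; by \<open>cross\<close> all
        terms containing \<open>?v\<close> and \<open>?vt\<close> cancel.\<close>
      using eq cross[OF t] wr[OF t] by algebra
  qed
  have uu: "?u t = ?ut t" if t: "t \<in> {0..T}" for t
  proof (rule ccontr)
    assume "?u t \<noteq> ?ut t"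
    then have eq: "?ut t = - ?u t"
      using sq[OF t] by (auto simp: power2_eq_iff)
    \<comment> \<open>With opposite signs the two approximation errors would have to add up to twice
      the hyperbolic cosine, which exceeds their joint bound.\<close>
    have "2 * of_real (cosh (k * t)) = - (?u t - of_real (cosh (k * t))) - (?ut t - of_real (cosh (k * t)))"
      by (simp add: eq)
    then have "norm (2 * complex_of_real (cosh (k * t))) \<le> norm (?u t - of_real (cosh (k * t))) + norm (?ut t - of_real (cosh (k * t)))"
      by (metis norm_minus_cancel norm_triangle_ineq4)
    also have "\<dots> < exp (k * t) / 2"
      using close[OF t] by linarith
    finally have "2 * cosh (k * t) < exp (k * t) / 2"
      by (simp add: norm_mult)
    then show False
      using cosh[of t] exp_gt_zero[of "k * t"] by linarith
  qed
  have vv: "?v t = ?vt t" if t: "t \<in> {0..T}" for t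
    using sol[OF t] solt[OF t] uu t by (blast intro: unique)
  show "h = ht"
    using vv[of 0] T sl_uv_0[OF p, of h lam] sl_uv_0[OF pt, of ht lam] by simp
  assume t: "t \<in> {0..T}"
  have "(of_real (p t) - lam) * ?u t = (of_real (pt t) - lam) * ?ut t"
    using sol[OF t] solt[OF t] vv t by (blast intro: unique)
  then show "p t = pt t"
    using u0[OF t] uu[OF t] by simp
qed

section \<open>Reduction of the conformable problem\<close>

text \<open>In the variable \<open>t = x\<^sup>a / a\<close> the conformable derivative becomes the ordinary one.\<close>

definition conf_time :: "real \<Rightarrow> real \<Rightarrow> real" where
  "conf_time a x = x powr a / a"

text \<open>The inverse of \<open>conf_time\<close> on the half-line.\<close>

definition conf_pos :: "real \<Rightarrow> real \<Rightarrow> real" where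
  "conf_pos a t = (a * t) powr (1 / a)"

text \<open>Links the difference quotient of \<open>conf_has_deriv\<close> to the calculus of vector
  derivatives, also for restricted domains.\<close>

lemma has_vector_derivative_iff_quotient:
  "(f has_vector_derivative D) (at x within S) \<longleftrightarrow>
    ((\<lambda>y. (f y - f x) /\<^sub>R (y - x)) \<longlongrightarrow> D) (at x within S)"
proof -
  have "eventually (\<lambda>y. norm (f y - f x - (y - x) *\<^sub>R D) / norm (y - x) =
      norm ((f y - f x) /\<^sub>R (y - x) - D)) (at x within S)"
    unfolding eventually_at_filter
  proof (intro always_eventually allI impI)
    fix y assume "y \<noteq> x"
    then have "(f y - f x) /\<^sub>R (y - x) - D = (f y - f x - (y - x) *\<^sub>R D) /\<^sub>R (y - x)"
      by (simp add: scaleR_diff_right)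
    then show "norm (f y - f x - (y - x) *\<^sub>R D) / norm (y - x) = norm ((f y - f x) /\<^sub>R (y - x) - D)"
      by (simp add: divide_inverse mult.commute)
  qed
  then have "(f has_vector_derivative D) (at x within S) \<longleftrightarrow>
      ((\<lambda>y. norm ((f y - f x) /\<^sub>R (y - x) - D)) \<longlongrightarrow> 0) (at x within S)"
    unfolding has_vector_derivative_def has_derivative_iff_norm
    by (simp add: bounded_linear_scaleR_left tendsto_cong)
  also have "\<dots> \<longleftrightarrow> ((\<lambda>y. (f y - f x) /\<^sub>R (y - x)) \<longlongrightarrow> D) (at x within S)"
    by (simp add: tendsto_norm_zero_iff Lim_null[symmetric])
  finally show ?thesis .
qed

context
  fixes a T :: real
  assumes a: "0 < a" and T_def: "T = conf_time a pi"
begin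

lemma conf_time_pi_pos: "0 < T"
  using a by (simp add: T_def conf_time_def)

lemma conf_pos_conf_time: "0 \<le> x \<Longrightarrow> conf_pos a (conf_time a x) = x"
  using a by (simp add: conf_pos_def conf_time_def powr_powr)

lemma conf_time_conf_pos: "0 \<le> t \<Longrightarrow> conf_time a (conf_pos a t) = t"
  using a by (simp add: conf_pos_def conf_time_def powr_powr)

lemma conf_time_0: "conf_time a 0 = 0"
  by (simp add: conf_time_def)

lemma conf_pos_0: "conf_pos a 0 = 0"
  by (simp add: conf_pos_def)

lemma conf_pos_T: "conf_pos a T = pi"
  unfolding T_def by (rule conf_pos_conf_time) simp

lemma conf_time_strict_mono: "0 \<le> x \<Longrightarrow> x < y \<Longrightarrow> conf_time a x < conf_time a y"
  using a by (simp add: conf_time_def divide_strict_right_mono powr_less_mono2)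

lemma conf_pos_strict_mono: "0 \<le> s \<Longrightarrow> s < t \<Longrightarrow> conf_pos a s < conf_pos a t"
  using a by (simp add: conf_pos_def powr_less_mono2)

lemma conf_time_mem: "x \<in> {0..pi} \<Longrightarrow> conf_time a x \<in> {0..T}"
  using conf_time_strict_mono[of x pi] a
  by (cases "x = pi") (auto simp: T_def conf_time_def)

lemma conf_time_mem': "x \<in> {0<..pi} \<Longrightarrow> conf_time a x \<in> {0<..T}"
  using conf_time_mem[of x] conf_time_strict_mono[of 0 x] by (auto simp: conf_time_0)

lemma conf_pos_mem: "t \<in> {0..T} \<Longrightarrow> conf_pos a t \<in> {0..pi}"
  using conf_pos_strict_mono[of t T]
  by (cases "t = T") (auto simp: conf_pos_T, simp add: conf_pos_def)

lemma conf_pos_mem': "t \<in> {0<..T} \<Longrightarrow> conf_pos a t \<in> {0<..pi}"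
  using conf_pos_mem[of t] conf_pos_strict_mono[of 0 t] by (auto simp: conf_pos_0)

lemma continuous_on_conf_time: "continuous_on {0..} (conf_time a)"
  unfolding conf_time_def using a by (intro continuous_intros continuous_on_powr') auto

lemma continuous_on_conf_pos: "continuous_on {0..} (conf_pos a)"
  unfolding conf_pos_def using a by (intro continuous_intros continuous_on_powr') auto

lemma continuous_on_compose_conf_pos:
  "continuous_on {0..pi} f \<Longrightarrow> continuous_on {0..T} (\<lambda>t. f (conf_pos a t))"
  using conf_pos_mem
  by (auto intro!: continuous_on_compose2[of "{0..pi}" f] continuous_on_subset[OF continuous_on_conf_pos])

lemma continuous_on_compose_conf_time:
  "continuous_on {0..T} f \<Longrightarrow> continuous_on {0..pi} (\<lambda>x. f (conf_time a x))"
  using conf_time_mem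
  by (auto intro!: continuous_on_compose2[of "{0..T}" f] continuous_on_subset[OF continuous_on_conf_time])

lemma conf_time_deriv:
  assumes "0 < x"
  shows "(conf_time a has_real_derivative x powr (a - 1)) (at x)"
  unfolding conf_time_def
  by (rule derivative_eq_intros refl assms)+ (use a in \<open>auto simp: field_simps\<close>)

lemma conf_pos_deriv:
  assumes x: "0 < x"
  shows "(conf_pos a has_real_derivative x powr (1 - a)) (at (conf_time a x))"
proof -
  have "(conf_pos a has_real_derivative (a * conf_time a x) powr (1 / a - 1)) (at (conf_time a x))"
    unfolding conf_pos_def using a x by (auto intro!: derivative_eq_intros simp: conf_time_def)
  also have "(a * conf_time a x) powr (1 / a - 1) = x powr (1 - a)"
    using a by (simp add: conf_time_def powr_powr right_diff_distrib)
  finally show ?thesis .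
qed

text \<open>The increment \<open>e\<close> and the time \<open>t\<close> are functions of each other
  with slope 1 at the base point. The chain rule in both directions gives the equivalence, and since
  the domains correspond, it includes the one-sided case at \<open>pi\<close>.\<close>

lemma conf_has_deriv_iff:
  assumes x: "x \<in> {0<..pi}"
  shows "conf_has_deriv a f D x \<longleftrightarrow>
    ((\<lambda>t. f (conf_pos a t)) has_vector_derivative D) (at (conf_time a x) within {0..T})"
proof -
  define c where "c = x powr (1 - a)"
  have c: "0 < c"
    using x by (simp add: c_def)
  define E where "E = {e. x + e * c \<in> {0..pi}}"
  define g where "g = (\<lambda>e. f (x + e * c))"
  have pt: "conf_pos a (conf_time a x) = x"
    using x by (intro conf_pos_conf_time) auto
  have "conf_has_deriv a f D x \<longleftrightarrow> (g has_vector_derivative D) (at 0 within E)"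
    using x by (simp add: conf_has_deriv_def has_vector_derivative_iff_quotient g_def E_def c_def)
  also have "\<dots> \<longleftrightarrow> ((\<lambda>t. f (conf_pos a t)) has_vector_derivative D) (at (conf_time a x) within {0..T})"
  proof
    assume g: "(g has_vector_derivative D) (at 0 within E)"
    \<comment> \<open>The increment that leads from \<open>x\<close> to the position at time
      \<open>t\<close>; dividing by \<open>c\<close> normalises the slope to 1.\<close>
    define m where "m = (\<lambda>t. (conf_pos a t - x) / c)"
    have m0: "m (conf_time a x) = 0"
      by (simp add: m_def pt)
    have "(m has_real_derivative 1) (at (conf_time a x))"
      unfolding m_def using x c
      by (auto intro!: derivative_eq_intros conf_pos_deriv simp: c_def)
    then have "(m has_vector_derivative 1) (at (conf_time a x) within {0..T})"
      by (simp add: has_real_derivative_iff_has_vector_derivative has_vector_derivative_at_within)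
    moreover have "m ` {0..T} \<subseteq> E"
      using conf_pos_mem c by (auto simp: m_def E_def)
    then have "(g has_vector_derivative D) (at (m (conf_time a x)) within m ` {0..T})"
      unfolding m0 using g by (rule has_vector_derivative_within_subset[rotated])
    ultimately have "((g \<circ> m) has_vector_derivative 1 *\<^sub>R D) (at (conf_time a x) within {0..T})"
      by (rule vector_diff_chain_within)
    then show "((\<lambda>t. f (conf_pos a t)) has_vector_derivative D) (at (conf_time a x) within {0..T})"
      using c by (simp add: o_def g_def m_def)
  next
    assume f: "((\<lambda>t. f (conf_pos a t)) has_vector_derivative D) (at (conf_time a x) within {0..T})"
    define m where "m = (\<lambda>e. conf_time a (x + e * c))"
    have m0: "m 0 = conf_time a x"
      by (simp add: m_def)
    have "(conf_time a has_real_derivative x powr (a - 1)) (at (x + 0 * c))"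
      using x by (simp add: conf_time_deriv)
    then have "(m has_real_derivative x powr (a - 1) * c) (at 0)"
      unfolding m_def by (rule DERIV_chain2) (auto intro!: derivative_eq_intros)
    moreover have "x powr (a - 1) * c = 1"
      using x by (simp add: c_def flip: powr_add)
    ultimately have "(m has_vector_derivative 1) (at 0 within E)"
      by (simp add: has_real_derivative_iff_has_vector_derivative has_vector_derivative_at_within)
    moreover have "m ` E \<subseteq> {0..T}"
      using conf_time_mem by (auto simp: m_def E_def simp del: atLeastAtMost_iff)
    then have "((\<lambda>t. f (conf_pos a t)) has_vector_derivative D) (at (m 0) within m ` E)"
      unfolding m0 using f by (rule has_vector_derivative_within_subset[rotated])
    ultimately have "(((\<lambda>t. f (conf_pos a t)) \<circ> m) has_vector_derivative 1 *\<^sub>R D) (at 0 within E)"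
      by (rule vector_diff_chain_within)
    then have "(((\<lambda>t. f (conf_pos a t)) \<circ> m) has_vector_derivative D) (at 0 within E)"
      by simp
    then show "(g has_vector_derivative D) (at 0 within E)"
    proof (rule has_vector_derivative_transform[rotated 2])
      show "0 \<in> E"
        using x by (simp add: E_def)
      show "g e = ((\<lambda>t. f (conf_pos a t)) \<circ> m) e" if "e \<in> E" for e
        using that by (simp add: g_def m_def E_def conf_pos_conf_time)
    qed
  qed
  finally show ?thesis .
qed

section \<open>Correspondence of solutions\<close>

text \<open>The equation for \<open>v\<close> is not assumed at the endpoints. At \<open>T\<close>, where nothing is known about
  continuity of \<open>v\<close>, the value is identified through the one-sided derivative of \<open>u\<close>.\<close>

lemma sl_sol_of_interior:
  assumes p: "continuous_on {0..T} p" and cu: "continuous_on {0..T} u"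
    and du: "\<And>t. t \<in> {0<..T} \<Longrightarrow> (u has_vector_derivative v t) (at t within {0..T})"
    and v0: "(v \<longlongrightarrow> v 0) (at_right 0)"
    and dv: "\<And>t. t \<in> {0<..<T} \<Longrightarrow> (v has_vector_derivative (of_real (p t) - lam) * u t) (at t within {0..T})"
  shows "sl_sol T p lam u v"
proof -
  let ?G = "\<lambda>t. (of_real (p t) - lam) * u t"
  have cG: "continuous_on {0..T} ?G"
    by (intro continuous_intros p cu)
  have at: "at t within {0..T} = at t" if "t \<in> {0<..<T}" for t :: real
    using that by (intro at_within_interior) (auto simp: interior_atLeastAtMost_real)
  \<comment> \<open>\<open>w\<close> is the primitive that \<open>v\<close> has to equal. Equal
    derivatives and \<open>v0\<close> give \<open>v = w\<close> on \<open>[0, T)\<close>;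
    integrating \<open>w\<close> shows that \<open>u\<close> has derivative \<open>w\<close> on the
    whole interval, which settles \<open>T\<close>.\<close>
  define w where "w = (\<lambda>t. v 0 + integral {0..t} ?G)"
  have dw: "(w has_vector_derivative ?G t) (at t within {0..T})" if "t \<in> {0..T}" for t
    using has_vector_derivative_add[OF has_vector_derivative_const integral_has_vector_derivative[OF cG that]]
    by (simp add: w_def)
  have cw: "continuous_on {0..T} w"
    by (auto intro: has_vector_derivative_continuous[OF dw] simp: continuous_on_eq_continuous_within)
  have vw: "v t = w t" if t: "0 \<le> t" "t < T" for t
  proof -
    have "continuous (at s within {0..t}) v" if s: "s \<in> {0..t}" for s
    proof (cases "s = 0")
      case True
      then show ?thesis
        using v0 t(1)
        by (cases "t = 0") (simp add: continuous_within at_within_def, auto simp: continuous_within at_within_Icc_at_right)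
    next
      case False
      then have "(v has_vector_derivative ?G s) (at s within {0..t})"
        using t s by (intro has_vector_derivative_within_subset[OF dv]) auto
      then show ?thesis
        by (rule has_vector_derivative_continuous)
    qed
    then have "continuous_on {0..t} v"
      by (simp add: continuous_on_eq_continuous_within)
    moreover have "continuous_on {0..t} w"
      using t by (intro continuous_on_subset[OF cw]) auto
    ultimately have c: "continuous_on {0..t} (\<lambda>s. v s - w s)"
      by (rule continuous_on_diff)
    have "((\<lambda>s. v s - w s) has_vector_derivative 0) (at s)" if s: "s \<in> {0<..<t}" for s
    proof -
      have s': "s \<in> {0<..<T}"
        using s t by auto
      have "(v has_vector_derivative ?G s) (at s)" "(w has_vector_derivative ?G s) (at s)"
        using dv[OF s'] dw[of s] s' unfolding at[OF s'] by auto
      from has_vector_derivative_diff[OF this] show ?thesis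
        by simp
    qed
    from fundamental_theorem_of_calculus_interior[OF t(1) c this]
    have "(v t - w t) - (v 0 - w 0) = 0"
      by (simp add: has_integral_0_eq)
    then show ?thesis
      by (simp add: w_def)
  qed
  have uw: "u t = u 0 + integral {0..t} w" if t: "t \<in> {0..T}" for t
  proof -
    have "continuous_on {0..t} u"
      using t by (intro continuous_on_subset[OF cu]) auto
    moreover have "(u has_vector_derivative w s) (at s)" if s: "s \<in> {0<..<t}" for s
    proof -
      have s': "s \<in> {0<..<T}"
        using s t by auto
      show ?thesis
        using du[of s] s' vw[of s] unfolding at[OF s'] by auto
    qed
    ultimately have "(w has_integral u t - u 0) {0..t}"
      using t by (intro fundamental_theorem_of_calculus_interior) auto
    then show ?thesis
      by (simp add: integral_unique)
  qed
  have du': "(u has_vector_derivative w t) (at t within {0..T})" if t: "t \<in> {0..T}" for t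
    using has_vector_derivative_add[OF has_vector_derivative_const integral_has_vector_derivative[OF cw t]]
    by (intro has_vector_derivative_transform[OF t uw]) auto
  have "at T within {0..T} \<noteq> bot"
    using conf_time_pi_pos by (simp add: trivial_limit_within islimpt_Icc)
  then have "v T = w T"
    using du[of T] du'[of T] conf_time_pi_pos by (auto intro: vector_derivative_unique_within)
  then have vw: "v t = w t" if "t \<in> {0..T}" for t
    using vw[of t] that by (cases "t = T") auto
  show ?thesis
    unfolding sl_sol_def
    using du' vw by (auto intro!: has_vector_derivative_transform[OF _ _ dw])
qed

lemma conf_sol_imp_sl_sol:
  fixes y Dy :: "real \<Rightarrow> complex"
  assumes q: "continuous_on {0..pi} q" and s: "conf_sol a q lam y Dy"
  shows "sl_sol T (\<lambda>t. q (conf_pos a t)) lam (\<lambda>t. y (conf_pos a t)) (\<lambda>t. Dy (conf_pos a t))"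
proof (rule sl_sol_of_interior)
  show "continuous_on {0..T} (\<lambda>t. q (conf_pos a t))" "continuous_on {0..T} (\<lambda>t. y (conf_pos a t))"
    using q s by (auto intro!: continuous_on_compose_conf_pos simp: conf_sol_def)
  show "((\<lambda>t. y (conf_pos a t)) has_vector_derivative Dy (conf_pos a t)) (at t within {0..T})"
    if t: "t \<in> {0<..T}" for t
    using conf_has_deriv_iff[OF conf_pos_mem'[OF t], of y "Dy (conf_pos a t)"] s conf_pos_mem'[OF t] t
    by (simp add: conf_sol_def conf_time_conf_pos)
  show "((\<lambda>t. Dy (conf_pos a t)) has_vector_derivative (of_real (q (conf_pos a t)) - lam) * y (conf_pos a t))
      (at t within {0..T})" if t: "t \<in> {0<..<T}" for t
  proof -
    have t': "t \<in> {0<..T}"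
      using t by auto
    have "conf_pos a t \<in> {0<..<pi}"
      using conf_pos_mem'[OF t'] conf_pos_strict_mono[of t T] t by (auto simp: conf_pos_T)
    then show ?thesis
      using conf_has_deriv_iff[OF conf_pos_mem'[OF t'], of Dy "(of_real (q (conf_pos a t)) - lam) * y (conf_pos a t)"] s t
      by (simp add: conf_sol_def conf_time_conf_pos)
  qed
  \<comment> \<open>Positive times tending to 0 have positive positions tending to 0, so the limit
    defining \<open>Dy 0\<close> carries over.\<close>
  have "(conf_pos a \<longlongrightarrow> conf_pos a 0) (at_right 0)"
    using continuous_on_conf_pos unfolding continuous_on_def
    by (auto intro: tendsto_within_subset)
  moreover have "eventually (\<lambda>t. conf_pos a t \<in> {0<..}) (at_right 0)"
    using conf_pos_strict_mono[of 0] by (auto simp: eventually_at_filter conf_pos_0)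
  ultimately have "filterlim (conf_pos a) (at_right 0) (at_right 0)"
    by (simp add: filterlim_at conf_pos_0 eventually_conj_iff eventually_mono)
  then show "((\<lambda>t. Dy (conf_pos a t)) \<longlongrightarrow> Dy (conf_pos a 0)) (at_right 0)"
    using s by (auto intro: filterlim_compose simp: conf_sol_def conf_pos_0)
qed

lemma sl_sol_imp_conf_sol:
  assumes s: "sl_sol T (\<lambda>t. q (conf_pos a t)) lam u v"
  shows "conf_sol a q lam (\<lambda>x. u (conf_time a x)) (\<lambda>x. v (conf_time a x))"
  unfolding conf_sol_def
proof (intro conjI ballI)
  show "continuous_on {0..pi} (\<lambda>x. u (conf_time a x))"
    by (intro continuous_on_compose_conf_time sl_sol_continuous[OF s])
  have d: "conf_has_deriv a (\<lambda>x. f (conf_time a x)) D x"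
    if x: "x \<in> {0<..pi}" and f: "(f has_vector_derivative D) (at (conf_time a x) within {0..T})"
    for f :: "real \<Rightarrow> complex" and D x
    unfolding conf_has_deriv_iff[OF x]
    using conf_time_mem'[OF x]
    by (intro has_vector_derivative_transform[OF _ _ f]) (auto simp: conf_time_conf_pos)
  have m: "conf_time a x \<in> {0..T}" if "x \<in> {0<..pi}" for x
    using conf_time_mem'[OF that] by auto
  note s' = s[unfolded sl_sol_def, rule_format, OF m]
  show "conf_has_deriv a (\<lambda>x. u (conf_time a x)) (v (conf_time a x)) x" if "x \<in> {0<..pi}" for x
    using d s' that by blast
  show "conf_has_deriv a (\<lambda>x. v (conf_time a x)) ((of_real (q x) - lam) * u (conf_time a x)) x"
    if "x \<in> {0<..<pi}" for x
    using d[of x v] s'[of x] that by (simp add: conf_pos_conf_time)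
  have "continuous_on {0..pi} (\<lambda>x. v (conf_time a x))"
    by (intro continuous_on_compose_conf_time sl_sol_continuous[OF s])
  then have "((\<lambda>x. v (conf_time a x)) \<longlongrightarrow> v (conf_time a 0)) (at 0 within {0..pi})"
    by (auto simp: continuous_on_def)
  then show "((\<lambda>x. v (conf_time a x)) \<longlongrightarrow> v (conf_time a 0)) (at_right 0)"
    by (simp add: at_within_Icc_at_right)
qed

section \<open>Correspondence of the spectral data\<close>

text \<open>The weight is the Jacobian of the substitution. It is unbounded at 0 when
  \<open>a < 1\<close>, hence the form of the fundamental theorem that differentiates the continuous
  primitive only in the interior.\<close>

lemma conf_integral:
  fixes f :: "real \<Rightarrow> real"
  assumes f: "continuous_on {0..T} f"
  shows "integral {0..pi} (\<lambda>x. f (conf_time a x) * x powr (a - 1)) = integral {0..T} f"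
proof -
  have c: "continuous_on {0..T} (\<lambda>t. integral {0..t} f)"
    by (intro indefinite_integral_continuous_1 integrable_continuous_real f)
  have "((\<lambda>x. f (conf_time a x) * x powr (a - 1)) has_integral
      integral {0..conf_time a pi} f - integral {0..conf_time a 0} f) {0..pi}"
  proof (rule fundamental_theorem_of_calculus_interior)
    show "continuous_on {0..pi} (\<lambda>x. integral {0..conf_time a x} f)"
      by (rule continuous_on_compose_conf_time[OF c])
    fix x assume x: "x \<in> {0<..<pi}"
    then have tx: "conf_time a x \<in> {0<..<T}"
      using conf_time_mem'[of x] conf_time_strict_mono[of x pi] by (auto simp: T_def)
    have "((\<lambda>t. integral {0..t} f) has_vector_derivative f (conf_time a x)) (at (conf_time a x) within {0..T})"
      using tx by (intro integral_has_vector_derivative f) auto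
    moreover have "at (conf_time a x) within {0..T} = at (conf_time a x)"
      using tx by (intro at_within_interior) (auto simp: interior_atLeastAtMost_real)
    ultimately have "((\<lambda>t. integral {0..t} f) has_real_derivative f (conf_time a x)) (at (conf_time a x))"
      by (simp add: has_real_derivative_iff_has_vector_derivative)
    from DERIV_chain2[OF this conf_time_deriv] x
    show "((\<lambda>x. integral {0..conf_time a x} f) has_vector_derivative f (conf_time a x) * x powr (a - 1)) (at x)"
      by (simp add: has_real_derivative_iff_has_vector_derivative)
  qed auto
  then show ?thesis
    by (simp add: T_def conf_time_0 integral_unique)
qed

text \<open>The left boundary condition makes an eigenfunction \<open>y 0\<close> times \<phi>, with
  \<open>y 0 \<noteq> 0\<close> because it is not identically zero. The right boundary condition
  then says that \<Delta> vanishes.\<close>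

lemma conf_eigenvalue_iff:
  assumes q: "continuous_on {0..pi} q"
  shows "conf_eigenvalue a q h H z \<longleftrightarrow> sl_char T (\<lambda>t. q (conf_pos a t)) h H z = 0"
proof -
  let ?p = "\<lambda>t. q (conf_pos a t)"
  let ?u = "sl_u ?p h z" and ?v = "sl_v ?p h z"
  have p: "continuous_on {0..T} ?p"
    by (rule continuous_on_compose_conf_pos[OF q])
  note uv0 = sl_uv_0[OF p less_imp_le[OF conf_time_pi_pos], of h z]
  show ?thesis
  proof
    assume "conf_eigenvalue a q h H z"
    then obtain y Dy where y: "conf_sol a q z y Dy" "\<exists>x\<in>{0..pi}. y x \<noteq> 0"
      "Dy 0 - of_real h * y 0 = 0" "Dy pi + of_real H * y pi = 0"
      unfolding conf_eigenvalue_def by blast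
    note eq = sl_sol_unique[OF p conf_sol_imp_sl_sol[OF q y(1)] sl_uv_sol[OF p, of z h], of "y 0"]
    have yu: "y (conf_pos a t) = y 0 * ?u t" "Dy (conf_pos a t) = y 0 * ?v t" if "t \<in> {0..T}" for t
      by (rule eq[OF _ _ that]; use y(3) in \<open>simp add: uv0 conf_pos_0 mult.commute\<close>)+
    have "y 0 \<noteq> 0"
    proof
      assume y0: "y 0 = 0"
      obtain x where x: "x \<in> {0..pi}" "y x \<noteq> 0"
        using y(2) by blast
      then show False
        using yu(1)[OF conf_time_mem[OF x(1)]] by (simp add: y0 conf_pos_conf_time)
    qed
    moreover have "y 0 * sl_char T ?p h H z = 0"
      using y(4) yu[of T] conf_time_pi_pos by (simp add: sl_char_def conf_pos_T algebra_simps)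
    ultimately show "sl_char T ?p h H z = 0"
      by simp
  next
    assume z: "sl_char T ?p h H z = 0"
    have "conf_sol a q z (\<lambda>x. ?u (conf_time a x)) (\<lambda>x. ?v (conf_time a x))"
      by (rule sl_sol_imp_conf_sol[OF sl_uv_sol[OF p]])
    then show "conf_eigenvalue a q h H z"
      unfolding conf_eigenvalue_def
      using z uv0
      by (intro exI[of _ "\<lambda>x. ?u (conf_time a x)"] exI[of _ "\<lambda>x. ?v (conf_time a x)"])
         (auto simp: conf_time_0 sl_char_def T_def intro!: bexI[of _ 0])
  qed
qed

text \<open>The real solution is embedded into the complex numbers and identified with
  \<open>sl_u\<close> by uniqueness. Positivity, due to \<open>y 0 = 1\<close>, supplies the nonzero
  denominator of the residues.\<close>

lemma conf_norming_constant:
  fixes y Dy :: "real \<Rightarrow> real" and lam h :: real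
  assumes q: "continuous_on {0..pi} q" and s: "conf_sol a q lam y Dy" "y 0 = 1" "Dy 0 = h"
  defines "p \<equiv> \<lambda>t. q (conf_pos a t)"
  shows "integral {0..T} (\<lambda>t. (sl_u p h lam t)\<^sup>2) = of_real (integral {0..pi} (\<lambda>x. (y x)\<^sup>2 * x powr (a - 1)))"
    and "0 < integral {0..pi} (\<lambda>x. (y x)\<^sup>2 * x powr (a - 1))"
proof -
  have p: "continuous_on {0..T} p"
    unfolding p_def by (rule continuous_on_compose_conf_pos[OF q])
  note uv0 = sl_uv_0[OF p less_imp_le[OF conf_time_pi_pos], of h lam]
  have "conf_has_deriv a (\<lambda>x. complex_of_real (f x)) (of_real D) x" if "conf_has_deriv a f D x" for f D x
    using that unfolding conf_has_deriv_def
    by (auto dest!: tendsto_of_real[where 'a = complex] simp: scaleR_conv_of_real)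
  then have "conf_sol a q (complex_of_real lam) (\<lambda>x. of_real (y x)) (\<lambda>x. of_real (Dy x))"
    using s(1) unfolding conf_sol_def
    by (auto intro!: continuous_intros tendsto_of_real simp flip: of_real_diff of_real_mult)
  from conf_sol_imp_sl_sol[OF q this]
  have sol: "sl_sol T p (of_real lam) (\<lambda>t. of_real (y (conf_pos a t))) (\<lambda>t. of_real (Dy (conf_pos a t)))"
    unfolding p_def .
  have u: "sl_u p h lam t = of_real (y (conf_pos a t))" if "t \<in> {0..T}" for t
    using sl_sol_unique(1)[OF p sol sl_uv_sol[OF p], of 1 h t] that uv0 s(2,3)
    by (simp add: conf_pos_0)
  let ?f = "\<lambda>t. (y (conf_pos a t))\<^sup>2"
  have cf: "continuous_on {0..T} ?f"
    using s(1) by (intro continuous_intros continuous_on_compose_conf_pos) (auto simp: conf_sol_def)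
  have i: "integral {0..pi} (\<lambda>x. (y x)\<^sup>2 * x powr (a - 1)) = integral {0..T} ?f"
    unfolding conf_integral[OF cf, symmetric]
    by (intro integral_cong) (simp add: conf_pos_conf_time)
  have "integral {0..T} (\<lambda>t. (sl_u p h lam t)\<^sup>2) = integral {0..T} (\<lambda>t. complex_of_real (?f t))"
    by (intro integral_cong) (simp add: u)
  also have "\<dots> = of_real (integral {0..T} ?f)"
    by (intro integral_unique has_integral_of_real integrable_integral integrable_continuous_real cf)
  finally show "integral {0..T} (\<lambda>t. (sl_u p h lam t)\<^sup>2) = of_real (integral {0..pi} (\<lambda>x. (y x)\<^sup>2 * x powr (a - 1)))"
    by (simp add: i)
  have "integral {0..T} ?f \<noteq> 0"
    using integral_eq_0_iff[OF cf conf_time_pi_pos] conf_time_pi_pos s(2) by (auto simp: conf_pos_0 intro!: bexI[of _ 0])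
  moreover have "0 \<le> integral {0..T} ?f"
    by (intro integral_nonneg integrable_continuous_real cf) auto
  ultimately show "0 < integral {0..pi} (\<lambda>x. (y x)\<^sup>2 * x powr (a - 1))"
    by (simp add: i)
qed

end

section \<open>Conclusion for the conformable problem\<close>

theorem theorem3:
  fixes a h H ht Ht :: real
    and q qt :: "real \<Rightarrow> real"
    and lam lamt :: "nat \<Rightarrow> real"
    and phi Dphi phit Dphit :: "nat \<Rightarrow> real \<Rightarrow> real"
    and nc nct :: "nat \<Rightarrow> real"
  assumes a: "0 < a" "a \<le> 1"
    and q: "continuous_on {0..pi} q" and qt: "continuous_on {0..pi} qt"
    and eig: "strict_mono lam" "{\<mu>. conf_eigenvalue a q h H \<mu>} = range (\<lambda>n. complex_of_real (lam n))"
    and eigt: "strict_mono lamt" "{\<mu>. conf_eigenvalue a qt ht Ht \<mu>} = range (\<lambda>n. complex_of_real (lamt n))"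
    and phi: "\<And>n. conf_sol a q (lam n) (phi n) (Dphi n) \<and> phi n 0 = 1 \<and> Dphi n 0 = h"
    and phit: "\<And>n. conf_sol a qt (lamt n) (phit n) (Dphit n) \<and> phit n 0 = 1 \<and> Dphit n 0 = ht"
    and nc: "\<And>n. nc n = integral {0..pi} (\<lambda>x. (phi n x)\<^sup>2 * x powr (a - 1))"
    and nct: "\<And>n. nct n = integral {0..pi} (\<lambda>x. (phit n x)\<^sup>2 * x powr (a - 1))"
    and same_eig: "\<And>n. lam n = lamt n"
    and same_nc: "\<And>n. nc n = nct n"
  shows "(AE x in lebesgue_on {0..pi}. q x = qt x) \<and> h = ht \<and> H = Ht"
proof -
  define T where "T = conf_time a pi"
  define p where "p = (\<lambda>t. q (conf_pos a t))"
  define pt where "pt = (\<lambda>t. qt (conf_pos a t))"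
  note T = conf_time_pi_pos[OF a(1) T_def]
  have p: "continuous_on {0..T} p" and pt: "continuous_on {0..T} pt"
    unfolding p_def pt_def by (intro continuous_on_compose_conf_pos[OF a(1) T_def] q qt)+
  have zeros: "sl_char T p h H z = 0 \<longleftrightarrow> z \<in> range (\<lambda>n. complex_of_real (lam n))"
    and zerost: "sl_char T pt ht Ht z = 0 \<longleftrightarrow> z \<in> range (\<lambda>n. complex_of_real (lam n))" for z
    using eig(2) eigt(2) conf_eigenvalue_iff[OF a(1) T_def q, of h H z]
      conf_eigenvalue_iff[OF a(1) T_def qt, of ht Ht z] same_eig
    by (auto simp: p_def pt_def)
  have norming: "integral {0..T} (\<lambda>s. (sl_u p h (lam n) s)\<^sup>2) = of_real (nc n)"
    "integral {0..T} (\<lambda>s. (sl_u pt ht (lam n) s)\<^sup>2) = of_real (nc n)" "0 < nc n" for n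
    using conf_norming_constant[OF a(1) T_def q, of "lam n" "phi n" "Dphi n" h] phi[of n] nc[of n]
      conf_norming_constant(1)[OF a(1) T_def qt, of "lam n" "phit n" "Dphit n" ht] phit[of n] nct[of n]
      same_eig[of n] same_nc[of n]
    by (simp_all add: p_def pt_def)
  have nz: "integral {0..T} (\<lambda>s. (sl_u p h z s)\<^sup>2) \<noteq> 0"
    and nceq: "integral {0..T} (\<lambda>s. (sl_u p h z s)\<^sup>2) = integral {0..T} (\<lambda>s. (sl_u pt ht z s)\<^sup>2)"
    if "sl_char T p h H z = 0" for z
  proof -
    from that zeros obtain n where n: "z = of_real (lam n)"
      by auto
    show "integral {0..T} (\<lambda>s. (sl_u p h z s)\<^sup>2) \<noteq> 0"
      and "integral {0..T} (\<lambda>s. (sl_u p h z s)\<^sup>2) = integral {0..T} (\<lambda>s. (sl_u pt ht z s)\<^sup>2)"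
      using norming[of n] by (auto simp: n)
  qed
  have same: "sl_char T p h H z = 0 \<longleftrightarrow> sl_char T pt ht Ht z = 0" for z
    by (simp add: zeros zerost)
  have "complex_of_real h = of_real ht"
    by (rule sl_uniqueness(1)[OF T p pt same nz nceq])
  then have h: "h = ht"
    by simp
  have pp: "p t = pt t" if "t \<in> {0..T}" for t
    by (rule sl_uniqueness(2)[OF T p pt same nz nceq]) (use that in auto)
  have "q x = qt x" if x: "x \<in> {0..pi}" for x
    using pp[OF conf_time_mem[OF a(1) T_def x]] x by (simp add: p_def pt_def conf_pos_conf_time[OF a(1)])
  then have "AE x in lebesgue_on {0..pi}. q x = qt x"
    by (intro AE_I2) simp
  moreover have "H = Ht"
  proof -
    \<comment> \<open>With equal potentials and equal \<open>h\<close> both problems have the same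
      \<phi>, so at a common eigenvalue the two functions \<Delta> differ by
      \<open>(H - Ht) * sl_u p h z T\<close>, and both are 0.\<close>
    define z where "z = complex_of_real (lam 0)"
    have z: "sl_char T p h H z = 0" "sl_char T pt ht Ht z = 0"
      by (auto simp: zeros zerost z_def)
    have TT: "T \<in> {0..T}"
      using T by simp
    have "sl_sol T p z (sl_u pt ht z) (sl_v pt ht z)"
      using sl_uv_sol[OF pt, of z ht] pp by (simp add: sl_sol_def)
    from sl_sol_unique[OF p this sl_uv_sol[OF p, of z h], of 1 T] TT T
    have "sl_u pt ht z T = sl_u p h z T" "sl_v pt ht z T = sl_v p h z T"
      using sl_uv_0[OF p, of h z] sl_uv_0[OF pt, of ht z] h by auto
    then have "sl_char T p h H z - sl_char T pt ht Ht z = of_real (H - Ht) * sl_u p h z T"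
      by (simp add: sl_char_def algebra_simps)
    then have "of_real (H - Ht) * sl_u p h z T = 0"
      by (simp add: z)
    \<comment> \<open>At an eigenvalue \<psi> is a multiple of \<phi>, and \<psi> equals 1 at
      \<open>T\<close>.\<close>
    moreover have "sl_u p h z T \<noteq> 0"
      using sl_char_factor(2)[OF T p z(1) TT] sl_psi_T(1)[OF T p, of H z] by auto
    ultimately show ?thesis
      by simp
  qed
  ultimately show ?thesis
    using h by simp
qed

end
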